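(* Let $\Pi$ be a C123-problem. For any finite set of graphs $\mathcal{H}$, the problem $\Pi$ on $\mathcal{H}$-subgraph-free graphs is efficiently solvable if $\mathcal{H}$ contains a graph from $\mathcal{S}$ (or equivalently, if the class of $\mathcal{H}$-subgraph-free graphs has bounded treewidth), and computationally hard otherwise.
   Context: All graphs are finite, undirected and simple. A graph is $\mathcal{H}$-subgraph-free if it contains no graph $H\in\mathcal{H}$ as a (not necessarily induced) subgraph. A graph class has bounded treewidth if there is a constant $c$ such that every graph in it has treewidth at most $c$. A graph is subcubic if every vertex has degree at most $3$. For an integer $k\ge 1$, the $k$-subdivision of an edge $uv$ replaces $uv$ by a path of length $k+1$ with endpoints $u$ and $v$ (and $k$ new vertices); a $0$-subdivision leaves the edge unchanged. The $k$-subdivision of a graph $G$ is the graph obtained from $G$ by $k$-subdividing each edge. For a graph class $\mathcal{G}$, $\mathcal{G}^k$ is the class of $k$-subdivisions of the graphs in $\mathcal{G}$. For $p,q,r\ge 1$, the subdivided claw $S_{p,q,r}$ is obtained from the claw $K_{1,3}$ by $(p-1)$-, $(q-1)$- and $(r-1)$-subdividing its three edges, respectively. The set $\mathcal{S}$ consists of all non-empty disjoint unions of a set of zero or more subdivided claws and paths. A graph problem takes as input a graph (possibly with additional data); "$\Pi$ on (for) a graph class" means $\Pi$ with the input graph restricted to that class. The notions "efficiently solvable" and "computationally hard" (for a graph class) depend on context; for example, they can mean polynomial-time solvable and NP-complete, respectively. Efficient solvability is inherited by subclasses, and computational hardness is inherited by superclasses. A graph problem $\Pi$ is a C123-problem if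 it satisfies: (C1) $\Pi$ is efficiently solvable for every graph class of bounded treewidth; (C2) $\Pi$ is computationally hard for the class of subcubic graphs; (C3) $\Pi$ is computationally hard under edge subdivision of subcubic graphs, that is, there is an integer $k\ge 1$ such that: if $\Pi$ is computationally hard for the class $\mathcal{G}$ of subcubic graphs, then $\Pi$ is computationally hard for $\mathcal{G}^{kp}$ for every integer $p\ge 1$. *)

theory Defs
  imports "Graph_Theory.Graph_Theory"
begin

section \<open>Graphs and graph classes\<close>

text \<open>
  A finite simple undirected graph is a finite, symmetric, loop-free \<^typ>\<open>'a pair_pre_digraph\<close>
  (\<^const>\<open>pair_graph\<close>); the edge \<open>uv\<close> is the pair of arcs \<open>(u, v)\<close> and \<open>(v, u)\<close>.
  Vertices are natural numbers, so every finite graph occurs up to isomorphism and the graphs form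
  a single type.  The null graph is excluded by convention: it is a subgraph of every graph and is
  not a non-empty union of paths and subdivided claws.
\<close>

type_synonym ngraph = "nat pair_pre_digraph"

definition simple_graph :: "ngraph \<Rightarrow> bool" where
  "simple_graph G \<longleftrightarrow> pair_graph G \<and> pverts G \<noteq> {}"

definition graph_class :: "ngraph set \<Rightarrow> bool" where
  "graph_class \<G> \<longleftrightarrow> (\<forall>G\<in>\<G>. simple_graph G)"

definition contains_subgraph :: "ngraph \<Rightarrow> ngraph \<Rightarrow> bool" where
  "contains_subgraph G H \<longleftrightarrow>
     (\<exists>H' :: ngraph. subgraph (with_proj H') (with_proj G) \<and>
        digraph_iso (with_proj H) (with_proj H'))"

definition subgraph_free :: "ngraph set \<Rightarrow> ngraph set" where
  "subgraph_free \<H> = {G. simple_graph G \<and> (\<forall>H\<in>\<H>. \<not> contains_subgraph G H)}"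

text \<open>In a symmetric digraph every neighbour contributes exactly one outgoing arc.\<close>

definition subcubic_graphs :: "ngraph set" where
  "subcubic_graphs = {G. simple_graph G \<and> (\<forall>v\<in>pverts G. out_degree (with_proj G) v \<le> 3)}"


section \<open>Treewidth\<close>

text \<open>
  \<^const>\<open>Digraph_Component.tree\<close> is not suitable here: in a symmetric digraph each edge is a
  directed cycle \<open>u, v, u\<close>.  Cycles of the undirected graph are the directed cycles of length
  at least 3.
\<close>

definition is_tree :: "ngraph \<Rightarrow> bool" where
  "is_tree T \<longleftrightarrow> simple_graph T \<and> Digraph_Component.connected (with_proj T) \<and>
     \<not> (\<exists>p. pre_digraph.cycle (with_proj T) p \<and> 3 \<le> length p)"

definition tree_decomposition :: "ngraph \<Rightarrow> ngraph \<Rightarrow> (nat \<Rightarrow> nat set) \<Rightarrow> bool" where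
  "tree_decomposition G T B \<longleftrightarrow> is_tree T \<and>
     (\<Union>t\<in>pverts T. B t) = pverts G \<and>
     (\<forall>(u, v)\<in>parcs G. \<exists>t\<in>pverts T. u \<in> B t \<and> v \<in> B t) \<and>
     (\<forall>v\<in>pverts G. Digraph_Component.connected
        (induce_subgraph (with_proj T) {t \<in> pverts T. v \<in> B t}))"

definition decomposition_width :: "ngraph \<Rightarrow> (nat \<Rightarrow> nat set) \<Rightarrow> nat" where
  "decomposition_width T B = Max ((\<lambda>t. card (B t)) ` pverts T) - 1"

definition treewidth :: "ngraph \<Rightarrow> nat" where
  "treewidth G = (LEAST w. \<exists>T B. tree_decomposition G T B \<and> decomposition_width T B = w)"

definition bounded_treewidth :: "ngraph set \<Rightarrow> bool" where
  "bounded_treewidth \<G> \<longleftrightarrow> (\<exists>c. \<forall>G\<in>\<G>. treewidth G \<le> c)"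


section \<open>Edge subdivision\<close>

definition consecutive :: "'a list \<Rightarrow> ('a \<times> 'a) set" where
  "consecutive xs = set (zip xs (tl xs))"

text \<open>
  \<open>edge_subdivision s G G'\<close>: the graph \<open>G'\<close> arises from \<open>G\<close> by \<open>s {u, v}\<close>-subdividing each
  edge \<open>uv\<close>.  The list \<open>P u v\<close> holds the new vertices on the edge \<open>uv\<close>, in order from \<open>u\<close> to \<open>v\<close>.
\<close>

definition edge_subdivision :: "('a set \<Rightarrow> nat) \<Rightarrow> 'a pair_pre_digraph \<Rightarrow> 'a pair_pre_digraph \<Rightarrow> bool" where
  "edge_subdivision s G G' \<longleftrightarrow> (\<exists>P :: 'a \<Rightarrow> 'a \<Rightarrow> 'a list.
     (\<forall>(u, v)\<in>parcs G. length (P u v) = s {u, v} \<and> P v u = rev (P u v) \<and>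
        distinct (P u v) \<and> set (P u v) \<inter> pverts G = {}) \<and>
     (\<forall>(u, v)\<in>parcs G. \<forall>(x, y)\<in>parcs G. {u, v} \<noteq> {x, y} \<longrightarrow> set (P u v) \<inter> set (P x y) = {}) \<and>
     pverts G' = pverts G \<union> (\<Union>(u, v)\<in>parcs G. set (P u v)) \<and>
     parcs G' = (\<Union>(u, v)\<in>parcs G. consecutive (u # P u v @ [v])))"

definition subdivision_class :: "nat \<Rightarrow> ngraph set \<Rightarrow> ngraph set" where
  "subdivision_class k \<G> = {G'. \<exists>G\<in>\<G>. edge_subdivision (\<lambda>_. k) G G'}"


section \<open>Disjoint unions of paths and subdivided claws\<close>

definition is_path_graph :: "ngraph \<Rightarrow> bool" where
  "is_path_graph G \<longleftrightarrow> (\<exists>xs. xs \<noteq> [] \<and> distinct xs \<and> pverts G = set xs \<and>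
     parcs G = consecutive xs \<union> (consecutive xs)\<inverse>)"

definition claw :: ngraph where
  "claw = \<lparr> pverts = {0, 1, 2, 3}, parcs = {0} \<times> {1, 2, 3} \<union> {1, 2, 3} \<times> {0} \<rparr>"

definition is_subdivided_claw :: "nat \<Rightarrow> nat \<Rightarrow> nat \<Rightarrow> ngraph \<Rightarrow> bool" where
  "is_subdivided_claw p q r G \<longleftrightarrow>
     (\<exists>S. edge_subdivision
            (\<lambda>e. if e = {0, 1} then p - 1 else if e = {0, 2} then q - 1 else r - 1) claw S \<and>
          digraph_iso (with_proj S) (with_proj G))"

definition \<S> :: "ngraph set" where
  "\<S> = {G. simple_graph G \<and> (\<exists>\<C>. finite \<C> \<and>
     (\<forall>C\<in>\<C>. is_path_graph C \<or>
        (\<exists>p q r. 1 \<le> p \<and> 1 \<le> q \<and> 1 \<le> r \<and> is_subdivided_claw p q r C)) \<and>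
     pairwise (\<lambda>C D. disjnt (pverts C) (pverts D)) \<C> \<and>
     pverts G = (\<Union>C\<in>\<C>. pverts C) \<and> parcs G = (\<Union>C\<in>\<C>. parcs C))}"


section \<open>Graph problems\<close>

text \<open>
  An input is a graph together with additional data of type \<open>'d\<close>; each input has a set of correct
  answers of type \<open>'s\<close> (for a decision problem, a singleton subset of \<^typ>\<open>bool\<close>).
\<close>

record ('d, 's) graph_problem =
  inputs :: "(ngraph \<times> 'd) set"
  answers :: "ngraph \<times> 'd \<Rightarrow> 's set"

definition on_class :: "('d, 's) graph_problem \<Rightarrow> ngraph set \<Rightarrow> ('d, 's) graph_problem" where
  "on_class \<Phi> \<G> = \<Phi>\<lparr>inputs := {x \<in> inputs \<Phi>. fst x \<in> \<G>}\<rparr>"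

text \<open>
  The notions ``efficiently solvable'' and ``computationally hard'' depend on context and are
  therefore parameters \<open>eff\<close> and \<open>hard\<close>, applied to problems restricted to a graph class.
\<close>

definition subclass_inherited ::
    "(('d, 's) graph_problem \<Rightarrow> bool) \<Rightarrow> ('d, 's) graph_problem \<Rightarrow> bool" where
  "subclass_inherited eff \<Phi> \<longleftrightarrow> (\<forall>\<G> \<G>'. graph_class \<G>' \<and> \<G> \<subseteq> \<G>' \<and>
     eff (on_class \<Phi> \<G>') \<longrightarrow> eff (on_class \<Phi> \<G>))"

definition superclass_inherited ::
    "(('d, 's) graph_problem \<Rightarrow> bool) \<Rightarrow> ('d, 's) graph_problem \<Rightarrow> bool" where
  "superclass_inherited hard \<Phi> \<longleftrightarrow> (\<forall>\<G> \<G>'. graph_class \<G>' \<and> \<G> \<subseteq> \<G>' \<and>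
     hard (on_class \<Phi> \<G>) \<longrightarrow> hard (on_class \<Phi> \<G>'))"

definition C1 :: "(('d, 's) graph_problem \<Rightarrow> bool) \<Rightarrow> ('d, 's) graph_problem \<Rightarrow> bool" where
  "C1 eff \<Phi> \<longleftrightarrow> (\<forall>\<G>. graph_class \<G> \<and> bounded_treewidth \<G> \<longrightarrow> eff (on_class \<Phi> \<G>))"

definition C2 :: "(('d, 's) graph_problem \<Rightarrow> bool) \<Rightarrow> ('d, 's) graph_problem \<Rightarrow> bool" where
  "C2 hard \<Phi> \<longleftrightarrow> hard (on_class \<Phi> subcubic_graphs)"

definition C3 :: "(('d, 's) graph_problem \<Rightarrow> bool) \<Rightarrow> ('d, 's) graph_problem \<Rightarrow> bool" where
  "C3 hard \<Phi> \<longleftrightarrow> (\<exists>k\<ge>1. hard (on_class \<Phi> subcubic_graphs) \<longrightarrow>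
     (\<forall>p\<ge>1. hard (on_class \<Phi> (subdivision_class (k * p) subcubic_graphs))))"

definition C123_problem ::
    "(('d, 's) graph_problem \<Rightarrow> bool) \<Rightarrow> (('d, 's) graph_problem \<Rightarrow> bool) \<Rightarrow>
     ('d, 's) graph_problem \<Rightarrow> bool" where
  "C123_problem eff hard \<Phi> \<longleftrightarrow> C1 eff \<Phi> \<and> C2 hard \<Phi> \<and> C3 hard \<Phi>"

end

theory Submission
  imports Defs
begin

text \<open>
  Upper bound. If \<open>H \<in> \<S>\<close> has \<open>m\<close> components and order less than \<open>k\<close>, then \<open>H\<close> is a subgraph of
  \<open>m\<close> disjoint copies of the spider \<open>S\<^bsub>k,k,k\<^esub>\<close>. Deleting the vertices of a spider lowers the
  treewidth by at most \<open>3 k + 1\<close>, so it suffices to decompose spider-free graphs. In such a graph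
  take a longest path. Away from its ends, a vertex of the path has no chord (and no detour through
  a component of the rest) to a vertex at distance \<open>2 k\<close> or more, so the path is decomposed by
  sliding windows, each enlarged by the two ends. A component attached to the path lies over one
  window and has no path of more than \<open>k\<close> vertices starting next to the path: otherwise there is a
  spider, or a longer path. Hence it has a decomposition of width \<open>k\<close>.

  Lower bound and hardness. If no graph of \<open>\<H>\<close> lies in \<open>\<S>\<close> and \<open>k\<close> exceeds all their orders, then
  the \<open>k\<close>-subdivision of a subcubic graph contains none of them, since a subgraph with fewer than
  \<open>k\<close> vertices misses a vertex of every subdivided edge and therefore lies in \<open>\<S>\<close>. Subdivisions
  of subcubic graphs have unbounded treewidth: there are subcubic graphs with arbitrarily large
  complete minors, and some bag of a tree decomposition meets all sets of a pairwise intersecting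
  family of connected sets.
\<close>

section \<open>Vertex lists and homomorphisms\<close>

text \<open>No excluded grid theorem is used, and the constants come out of the construction. A
  chord spanning \<open>2 * k\<close> positions of a path leaves room between its endpoints for two
  legs of a spider, and this fixes the length of the windows. A vertex in an end of the path has
  fewer than \<open>k\<close> path vertices on one side and so cannot supply a third leg; chords
  inside the ends are therefore unrestricted, and the ends must be in every bag. Thus a window has
  at most \<open>k + k + 2 * k\<close> vertices, and the bags of an attached component add another
  \<open>k\<close>, which gives \<open>5 * k\<close>.

  For the lower bound, rows that meet pairwise in one edge replace walls. After subdivision each
  such edge has new vertices that both of its rows may claim, so the rows become pairwise
  intersecting sets, while no vertex is claimed more than twice. Hence a bag meeting all
  \<open>n\<close> rows has at least \<open>n / 2\<close> vertices.\<close>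

lemma consecutive_Nil [simp]: "consecutive [] = {}"
  and consecutive_single [simp]: "consecutive [x] = {}"
  and consecutive_Cons2 [simp]: "consecutive (x # y # zs) = insert (x, y) (consecutive (y # zs))"
  by (auto simp: consecutive_def)

lemma consecutive_Cons:
  "consecutive (x # xs) = (if xs = [] then {} else insert (x, hd xs) (consecutive xs))"
  by (cases xs) auto

lemma consecutive_append:
  "consecutive (xs @ ys) = consecutive xs \<union> consecutive ys \<union>
     (if xs = [] \<or> ys = [] then {} else {(last xs, hd ys)})"
  by (induction xs) (auto simp: consecutive_Cons)

lemma consecutive_rev: "consecutive (rev xs) = (consecutive xs)\<inverse>"
  by (induction xs) (auto simp: consecutive_Cons consecutive_append last_rev)

lemma consecutive_map: "consecutive (map f xs) = map_prod f f ` consecutive xs"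
  by (induction xs) (auto simp: consecutive_Cons hd_map)

lemma consecutive_conv_nth: "consecutive xs = {(xs ! i, xs ! Suc i) |i. Suc i < length xs}"
  by (auto simp: consecutive_def set_zip nth_tl)

lemma consecutive_take: "consecutive (take n xs) \<subseteq> consecutive xs"
  by (metis append_take_drop_id consecutive_append le_sup_iff subset_refl)

lemma consecutive_subset: "consecutive xs \<subseteq> set xs \<times> set xs"
  by (induction xs) (auto simp: consecutive_Cons)

section \<open>Simple graphs and subgraph containment as injective maps\<close>

lemma simple_graphD:
  assumes "simple_graph G"
  shows simple_graph_finite: "finite (pverts G)"
    and simple_graph_arcs: "parcs G \<subseteq> pverts G \<times> pverts G"
    and simple_graph_sym: "sym (parcs G)"
    and simple_graph_irrefl: "(x, x) \<notin> parcs G"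
    and simple_graph_nonempty: "pverts G \<noteq> {}"
proof -
  interpret pair_graph G using assms by (simp add: simple_graph_def)
  show "finite (pverts G)" by (rule pair_finite_verts)
  show "parcs G \<subseteq> pverts G \<times> pverts G" by (auto dest: in_arcsD1 in_arcsD2)
  show "sym (parcs G)" by (auto intro: symI arcs_symmetric)
  show "(x, x) \<notin> parcs G" using pair_no_loops by force
  show "pverts G \<noteq> {}" using assms by (simp add: simple_graph_def)
qed

lemma simple_graphI:
  assumes "finite (pverts G)" "parcs G \<subseteq> pverts G \<times> pverts G" "sym (parcs G)"
    and "\<And>x. (x, x) \<notin> parcs G" "pverts G \<noteq> {}"
  shows "simple_graph G"
proof -
  have "finite (parcs G)" using assms(1,2) finite_subset by blast
  moreover have "symmetric (with_proj G)" using assms(3) by (simp add: symmetric_def)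
  ultimately have "pair_graph G"
    using assms by unfold_locales (auto simp: )
  then show ?thesis using assms(5) by (simp add: simple_graph_def)
qed

lemma simple_graph_finite_arcs: "simple_graph G \<Longrightarrow> finite (parcs G)"
  using simple_graph_finite simple_graph_arcs by (meson finite_SigmaI finite_subset)

lemma simple_graph_wf: "simple_graph G \<Longrightarrow> wf_digraph (with_proj G)"
  using simple_graph_arcs[of G] unfolding wf_digraph_def by fastforce

text \<open>In \<open>with_proj\<close> graphs tail and head are \<open>fst\<close> and
  \<open>snd\<close>, so the vertex map of an isomorphism forces its arc map to be
  \<open>map_prod h h\<close>.\<close>

lemma digraph_iso_with_projD:
  assumes "digraph_iso (with_proj G) (with_proj H)"
  obtains h where "inj_on h (pverts G)" "pverts H = h ` pverts G" "parcs H = map_prod h h ` parcs G"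
proof -
  obtain f where f: "pre_digraph.digraph_isomorphism (with_proj G) f"
    "with_proj H = app_iso f (with_proj G)"
    using assms by (auto simp: digraph_iso_def)
  have eq: "iso_tail f = fst" "iso_head f = snd" "pverts H = iso_verts f ` pverts G"
    "parcs H = iso_arcs f ` parcs G"
    using f(2) by (simp_all add: with_proj_def app_iso_def)
  have "\<forall>a\<in>parcs G. iso_arcs f a = map_prod (iso_verts f) (iso_verts f) a"
    using f(1) eq(1,2) by (auto simp: pre_digraph.digraph_isomorphism_def prod_eq_iff)
  then have "parcs H = map_prod (iso_verts f) (iso_verts f) ` parcs G"
    using eq(4) by (auto intro: image_cong)
  moreover have "inj_on (iso_verts f) (pverts G)"
    using f(1) by (simp add: pre_digraph.digraph_isomorphism_def)
  ultimately show ?thesis using eq(3) that by blast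
qed

lemma digraph_iso_with_projI:
  assumes "wf_digraph (with_proj G)" "inj_on h (pverts G)"
    and "pverts H = h ` pverts G" "parcs H = map_prod h h ` parcs G"
  shows "digraph_iso (with_proj G) (with_proj H)"
proof -
  let ?f = "\<lparr>iso_verts = h, iso_arcs = map_prod h h, iso_head = snd, iso_tail = fst\<rparr>"
  have "parcs G \<subseteq> pverts G \<times> pverts G"
    using wf_digraph.tail_in_verts[OF assms(1)] wf_digraph.head_in_verts[OF assms(1)] by fastforce
  then have "inj_on (map_prod h h) (parcs G)"
    using assms(2) by (blast intro: inj_on_subset map_prod_inj_on)
  then have "pre_digraph.digraph_isomorphism (with_proj G) ?f"
    using assms by (auto simp: pre_digraph.digraph_isomorphism_def)
  moreover have "with_proj H = app_iso ?f (with_proj G)"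
    using assms(3,4) by (simp add: app_iso_def with_proj_def)
  ultimately show ?thesis unfolding digraph_iso_def by blast
qed

lemma contains_subgraphD:
  assumes "contains_subgraph G H"
  obtains f where "inj_on f (pverts H)" "f ` pverts H \<subseteq> pverts G" "map_prod f f ` parcs H \<subseteq> parcs G"
proof -
  obtain H' :: ngraph where H': "subgraph (with_proj H') (with_proj G)"
      "digraph_iso (with_proj H) (with_proj H')"
    using assms by (auto simp: contains_subgraph_def)
  obtain h where "inj_on h (pverts H)" "pverts H' = h ` pverts H" "parcs H' = map_prod h h ` parcs H"
    using digraph_iso_with_projD[OF H'(2)] .
  then show ?thesis using that[of h] H'(1) by (auto simp: subgraph_def)
qed

lemma contains_subgraphI:
  assumes "simple_graph G" "simple_graph H"
    and "inj_on f (pverts H)" "f ` pverts H \<subseteq> pverts G" "map_prod f f ` parcs H \<subseteq> parcs G"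
  shows "contains_subgraph G H"
proof -
  let ?H = "\<lparr>pverts = f ` pverts H, parcs = map_prod f f ` parcs H\<rparr>"
  have "wf_digraph (with_proj ?H)"
    using simple_graph_arcs[OF assms(2)] unfolding wf_digraph_def by fastforce
  then have "subgraph (with_proj ?H) (with_proj G)"
    using assms simple_graph_wf[OF assms(1)] by (auto simp: subgraph_def compatible_def)
  moreover have "digraph_iso (with_proj H) (with_proj ?H)"
    using digraph_iso_with_projI[OF simple_graph_wf[OF assms(2)] assms(3), of ?H] by simp
  ultimately show ?thesis unfolding contains_subgraph_def by blast
qed

section \<open>Building tree decompositions\<close>

lemma pcas_consecutive:
  "pcas u p v \<Longrightarrow> set p = consecutive (u # map snd p) \<and> last (u # map snd p) = v"
  by (induction p arbitrary: u) auto

lemma pcas_zip: "pcas u (zip (u # xs) xs) (last (u # xs))"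
  by (induction xs arbitrary: u) auto

text \<open>A \<open>cycle\<close> is a list of arcs. The heads of these arcs list the vertices of
  the cycle once each, one per arc, so the length bound carries over.\<close>

lemma long_cycle_iff:
  assumes "wf_digraph (with_proj T)"
  shows "(\<exists>p. pre_digraph.cycle (with_proj T) p \<and> 3 \<le> length p) \<longleftrightarrow>
    (\<exists>xs. distinct xs \<and> 3 \<le> length xs \<and> consecutive xs \<subseteq> parcs T \<and> (last xs, hd xs) \<in> parcs T)"
    (is "?L \<longleftrightarrow> ?R")
proof -
  interpret wf_digraph "with_proj T" by fact
  show ?thesis
  proof
    assume ?L
    then obtain p u where p: "awalk u p u" "distinct (tl (pawalk_verts u p))" "3 \<le> length p"
      by (auto simp: cycle_def awalk_verts_with_proj_eq)
    have cas: "pcas u p u" and sub: "set p \<subseteq> parcs T"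
      using p(1) by (auto simp: awalk_def cas_with_proj_eq)
    have "tl (pawalk_verts u p) = map snd p"
      using awalk_verts_conv'[of u p u] cas p(3)
      by (auto simp: awalk_verts_with_proj_eq cas_with_proj_eq)
    then have "distinct (map snd p)" using p(2) by simp
    moreover have "set p = consecutive (u # map snd p)" "last (u # map snd p) = u"
      using pcas_consecutive[OF cas] by auto
    moreover have "map snd p \<noteq> []" using p(3) by auto
    ultimately show ?R
      using sub p(3) by (intro exI[of _ "map snd p"]) (auto simp: consecutive_Cons)
  next
    assume ?R
    then obtain xs where xs: "distinct xs" "3 \<le> length xs" "consecutive xs \<subseteq> parcs T"
      "(last xs, hd xs) \<in> parcs T" by blast
    have ne: "xs \<noteq> []" using xs(2) by auto
    \<comment> \<open>Starting at \<open>last xs\<close> makes the heads of the arcs, in order,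
      exactly \<open>xs\<close>.\<close>
    define u where "u = last xs"
    define p where "p = zip (u # xs) xs"
    have cas: "pcas u p u" using pcas_zip[of u xs] ne by (simp add: p_def u_def)
    have snd: "map snd p = xs" unfolding p_def by (rule map_snd_zip_take[THEN trans]) simp
    have "set p = consecutive (u # xs)" by (simp add: p_def consecutive_def)
    then have sub: "set p \<subseteq> parcs T" using xs(3,4) ne by (auto simp: u_def consecutive_Cons)
    have len: "length p = length xs" by (simp add: p_def)
    have "u \<in> pverts T" using xs(4) head_in_verts tail_in_verts by (fastforce simp: u_def)
    then have "awalk u p u" using cas sub by (simp add: awalk_def cas_with_proj_eq)
    moreover have "tl (pawalk_verts u p) = xs"
      using awalk_verts_conv'[of u p u] cas len ne snd
      by (auto simp: awalk_verts_with_proj_eq cas_with_proj_eq)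
    ultimately show ?L
      using xs(1,2) len ne
      by (intro exI[of _ p]) (auto simp: cycle_def awalk_verts_with_proj_eq)
  qed
qed

lemma connected_with_proj_iff:
  assumes "sym (parcs T)" "parcs T \<subseteq> pverts T \<times> pverts T"
  shows "Digraph_Component.connected (with_proj T) \<longleftrightarrow>
    pverts T \<noteq> {} \<and> (\<forall>x\<in>pverts T. \<forall>y\<in>pverts T. (x, y) \<in> (parcs T)\<^sup>*)"
proof -
  have "mk_symmetric (with_proj T) = T"
    using assms(1) by (cases T) (auto simp: mk_symmetric_def dest: symD)
  moreover have "wf_digraph (with_proj T)"
    using assms(2) unfolding wf_digraph_def by fastforce
  then have "\<And>x y. x \<in> pverts T \<Longrightarrow> x \<rightarrow>\<^sup>*\<^bsub>with_proj T\<^esub> y \<longleftrightarrow> (x, y) \<in> (parcs T)\<^sup>*"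
    using wf_digraph.reachable_conv'[of "with_proj T"] by simp
  ultimately show ?thesis
    by (auto simp: Digraph_Component.connected_def strongly_connected_def)
qed

lemma connected_induce_iff:
  assumes "sym (parcs T)" "X \<subseteq> pverts T"
  shows "Digraph_Component.connected (induce_subgraph (with_proj T) X) \<longleftrightarrow>
    X \<noteq> {} \<and> (\<forall>x\<in>X. \<forall>y\<in>X. (x, y) \<in> (Restr (parcs T) X)\<^sup>*)"
proof -
  let ?T = "\<lparr>pverts = X, parcs = Restr (parcs T) X\<rparr>"
  have "induce_subgraph (with_proj T) X = with_proj ?T"
    by (auto simp: induce_subgraph_def with_proj_def)
  moreover have "sym (Restr (parcs T) X)" using assms(1) by (auto simp: sym_def)
  ultimately show ?thesis using connected_with_proj_iff[of ?T] by simp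
qed

text \<open>
  Tree decompositions of the graph induced by \<open>E\<close> on \<open>U\<close>, grown from the bag \<open>R\<close> by attaching
  leaves: a new bag \<open>B'\<close> is attached to an old bag \<open>B\<close> covering its old vertices. The number \<open>w\<close>
  bounds the size of the bags, that is, the width plus one.
\<close>

inductive decomposes :: "'a rel \<Rightarrow> nat \<Rightarrow> 'a set \<Rightarrow> 'a set \<Rightarrow> 'a set set \<Rightarrow> bool"
  for E w R where
  start: "finite R \<Longrightarrow> card R \<le> w \<Longrightarrow> decomposes E w R R {R}"
| add_bag: "decomposes E w R U \<B> \<Longrightarrow> B \<in> \<B> \<Longrightarrow> finite B' \<Longrightarrow> card B' \<le> w \<Longrightarrow> B' \<inter> U \<subseteq> B \<Longrightarrow>
    (\<And>x y. x \<in> B' - U \<Longrightarrow> y \<in> U - B' \<Longrightarrow> (x, y) \<notin> E \<and> (y, x) \<notin> E) \<Longrightarrow>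
    decomposes E w R (U \<union> B') (insert B' \<B>)"

lemma decomposes_mono: "decomposes E w R U \<B> \<Longrightarrow> w \<le> w' \<Longrightarrow> decomposes E w' R U \<B>"
  by (induction rule: decomposes.induct) (auto intro: decomposes.intros)

lemma decomposes_start: "decomposes E w R U \<B> \<Longrightarrow> R \<subseteq> U \<and> R \<in> \<B>"
  by (induction rule: decomposes.induct) auto

text \<open>\<open>X\<close> may overlap \<open>U\<close> and have any edges, since it is put into
  every bag. This serves for windows of a path, for single cut vertices and for deleted
  spiders.\<close>

lemma decomposes_Un:
  "decomposes E w R U \<B> \<Longrightarrow> finite X \<Longrightarrow> card X \<le> n \<Longrightarrow>
    decomposes E (w + n) (R \<union> X) (U \<union> X) ((\<union>) X ` \<B>)"
proof (induction rule: decomposes.induct)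
  case start
  then show ?case
    using decomposes.start[of "R \<union> X" "w + n" E] card_Un_le[of R X] by (simp add: Un_commute)
next
  case (add_bag U \<B> B B')
  have "decomposes E (w + n) (R \<union> X) ((U \<union> X) \<union> (X \<union> B')) (insert (X \<union> B') ((\<union>) X ` \<B>))"
  proof (rule decomposes.add_bag)
    show "decomposes E (w + n) (R \<union> X) (U \<union> X) ((\<union>) X ` \<B>)" using add_bag by blast
    show "X \<union> B \<in> (\<union>) X ` \<B>" using add_bag by blast
    show "finite (X \<union> B')" using add_bag by blast
    show "card (X \<union> B') \<le> w + n" using card_Un_le[of X B'] add_bag by linarith
    show "(X \<union> B') \<inter> (U \<union> X) \<subseteq> X \<union> B" using add_bag by blast
  qed (use add_bag in auto)
  then show ?case by (simp add: Un_ac)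
qed

text \<open>This gluing is why the start bag is a parameter of \<open>decomposes\<close>: the second
  decomposition is replayed on top of the first, with \<open>R'\<close> attached to
  \<open>B\<close>. As \<open>U\<close> meets \<open>U'\<close> only inside \<open>R'\<close>, the
  later bags keep their parents. The old bags survive and can be glued to again.\<close>

lemma decomposes_join:
  assumes "decomposes E w R' U' \<B>'" "decomposes E w R U \<B>" "B \<in> \<B>" "U \<inter> R' \<subseteq> B" "U \<inter> U' \<subseteq> R'"
    and "\<And>x y. x \<in> U' - U \<Longrightarrow> y \<in> U - U' \<Longrightarrow> (x, y) \<notin> E \<and> (y, x) \<notin> E"
  shows "\<exists>\<B>''. \<B> \<subseteq> \<B>'' \<and> decomposes E w R (U \<union> U') \<B>''"
proof -
  have "decomposes E w R (U \<union> U') (\<B> \<union> \<B>')"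
    using assms
  proof (induction rule: decomposes.induct)
    case start
    then show ?case using decomposes.add_bag[of E w R U \<B> B R'] by auto
  next
    case (add_bag U' \<B>' C C')
    have sub: "R' \<subseteq> U'" using decomposes_start[OF add_bag.hyps(1)] by blast
    have "decomposes E w R ((U \<union> U') \<union> C') (insert C' (\<B> \<union> \<B>'))"
    proof (rule decomposes.add_bag)
      show "decomposes E w R (U \<union> U') (\<B> \<union> \<B>')"
      proof (rule add_bag.IH)
        fix x y assume xy: "x \<in> U' - U" "y \<in> U - U'"
        show "(x, y) \<notin> E \<and> (y, x) \<notin> E"
        \<comment> \<open>A vertex of \<open>C'\<close> in \<open>U\<close> lies in
          \<open>R'\<close>, hence already in the smaller \<open>U'\<close>; so the edge condition
          descends to \<open>U'\<close>.\<close>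
        proof (cases "y \<in> C'")
          case True
          then have "y \<in> R'" using xy add_bag by blast
          then show ?thesis using xy sub by blast
        qed (use xy add_bag in blast)
      qed (use add_bag in blast)+
      show "C \<in> \<B> \<union> \<B>'" using add_bag by blast
      show "C' \<inter> (U \<union> U') \<subseteq> C" using add_bag.hyps(5) add_bag.prems(4) sub by blast
      fix x y assume xy: "x \<in> C' - (U \<union> U')" "y \<in> U \<union> U' - C'"
      show "(x, y) \<notin> E \<and> (y, x) \<notin> E"
      proof (cases "y \<in> U'")
        case True
        then show ?thesis using xy add_bag.hyps by blast
      next
        case False
        then show ?thesis using xy add_bag.prems by blast
      qed
    qed (use add_bag in blast)+
    then show ?case by (simp add: Un_ac)
  qed
  then show ?thesis by blast
qed

text \<open>Bags are numbered in order of attachment, so parents have smaller numbers. As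
  \<open>\<B>\<close> is only a set, a bag that is attached again gets a further number.\<close>

lemma decomposes_indexed:
  assumes "decomposes E w R U \<B>"
  shows "\<exists>(n :: nat) par B. 0 < n \<and> \<B> = B ` {..<n} \<and> U = (\<Union>i<n. B i) \<and>
    (\<forall>i<n. finite (B i) \<and> card (B i) \<le> w) \<and>
    (\<forall>i. 0 < i \<and> i < n \<longrightarrow> par i < i \<and> B i \<inter> (\<Union>j<i. B j) \<subseteq> B (par i)) \<and>
    (\<forall>x\<in>U. \<forall>y\<in>U. (x, y) \<in> E \<longrightarrow> (\<exists>i<n. x \<in> B i \<and> y \<in> B i))"
  using assms
proof (induction rule: decomposes.induct)
  case start
  then show ?case by (intro exI[of _ 1] exI[of _ "\<lambda>_. 0"] exI[of _ "\<lambda>_. R"]) auto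
next
  case (add_bag U \<B> C C')
  obtain n :: nat and par B where IH: "0 < n" "\<B> = B ` {..<n}" "U = (\<Union>i<n. B i)"
    "\<And>i. i < n \<Longrightarrow> finite (B i) \<and> card (B i) \<le> w"
    "\<And>i. 0 < i \<Longrightarrow> i < n \<Longrightarrow> par i < i \<and> B i \<inter> (\<Union>j<i. B j) \<subseteq> B (par i)"
    "\<And>x y. x \<in> U \<Longrightarrow> y \<in> U \<Longrightarrow> (x, y) \<in> E \<Longrightarrow> \<exists>i<n. x \<in> B i \<and> y \<in> B i"
    using add_bag.IH by metis
  obtain p where p: "p < n" "C = B p" using add_bag.hyps(2) IH(2) by auto
  let ?B = "B(n := C')" and ?par = "par(n := p)"
  have img: "?B ` {..<Suc n} = insert C' \<B>"
    using IH(2) by (auto simp: lessThan_Suc)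
  have un: "(\<Union>i<Suc n. ?B i) = U \<union> C'"
    using IH(3) by (auto simp: lessThan_Suc)
  have old: "(\<Union>j<i. ?B j) = (\<Union>j<i. B j)" if "i \<le> n" for i using that by auto
  have tree: "?par i < i \<and> ?B i \<inter> (\<Union>j<i. ?B j) \<subseteq> ?B (?par i)" if i: "0 < i" "i < Suc n" for i
  proof (cases "i = n")
    case True
    then show ?thesis using p add_bag.hyps(5) old[of n] IH(3) by auto
  next
    case False
    then show ?thesis using i IH(5)[of i] old[of i] by auto
  qed
  have edges: "\<exists>i<Suc n. x \<in> ?B i \<and> y \<in> ?B i" if "x \<in> U \<union> C'" "y \<in> U \<union> C'" "(x, y) \<in> E" for x y
  proof (cases "x \<in> C' \<and> y \<in> C'")
    case True
    then show ?thesis by (intro exI[of _ n]) simp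
  next
    case False
    then have "x \<in> U" "y \<in> U" using that add_bag.hyps(6) by blast+
    then obtain i where "i < n" "x \<in> B i" "y \<in> B i" using IH(6) \<open>(x, y) \<in> E\<close> by blast
    then show ?thesis by (intro exI[of _ i]) auto
  qed
  show ?case
    using img un tree edges IH(4) add_bag.hyps(3,4)
    by (intro exI[of _ "Suc n"] exI[of _ ?par] exI[of _ ?B]) (auto simp: less_Suc_eq)
qed

section \<open>From grown decompositions to tree decompositions\<close>

definition parent_tree :: "nat \<Rightarrow> (nat \<Rightarrow> nat) \<Rightarrow> ngraph" where
  "parent_tree n par = \<lparr>pverts = {..<n}, parcs = (\<Union>i\<in>{0<..<n}. {(i, par i), (par i, i)})\<rparr>"

text \<open>Iterating \<open>par\<close> descends strictly and, within \<open>X\<close>, can stop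
  only at \<open>t\<close>. So everything in \<open>X\<close> is joined to \<open>t\<close>.\<close>

lemma parent_tree_connected:
  assumes par: "\<And>i. 0 < i \<Longrightarrow> i < n \<Longrightarrow> par i < i"
    and X: "X \<subseteq> {..<n}" "t \<in> X" "\<And>i. i \<in> X \<Longrightarrow> i \<noteq> t \<Longrightarrow> 0 < i \<and> par i \<in> X"
    and xy: "x \<in> X" "y \<in> X"
  shows "(x, y) \<in> (Restr (parcs (parent_tree n par)) X)\<^sup>*"
proof -
  let ?R = "Restr (parcs (parent_tree n par)) X"
  have arc: "(i, par i) \<in> ?R \<and> (par i, i) \<in> ?R" if "i \<in> X" "i \<noteq> t" for i
    using that X by (force simp: parent_tree_def)
  have "i \<in> X \<longrightarrow> (i, t) \<in> ?R\<^sup>* \<and> (t, i) \<in> ?R\<^sup>*" for i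
  proof (induction i rule: less_induct)
    case (less i)
    show ?case
    proof (cases "i \<in> X \<and> i \<noteq> t")
      case True
      then have "(par i, t) \<in> ?R\<^sup>* \<and> (t, par i) \<in> ?R\<^sup>*" using less par X by blast
      then show ?thesis using arc[of i] True
        by (meson converse_rtrancl_into_rtrancl rtrancl.rtrancl_into_rtrancl)
    qed auto
  qed
  then show ?thesis using xy by (meson rtrancl_trans)
qed

text \<open>Long cycles are excluded by looking at the largest vertex: both of its neighbours on the
  cycle are smaller, hence both are its parent.\<close>

lemma parent_tree_is_tree:
  assumes n: "0 < n" and par: "\<And>i. 0 < i \<Longrightarrow> i < n \<Longrightarrow> par i < i"
  shows "is_tree (parent_tree n par)"
proof -
  let ?T = "parent_tree n par"
  have sub: "parcs ?T \<subseteq> pverts ?T \<times> pverts ?T"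
    using par less_trans[OF par] by (auto simp: parent_tree_def)
  have sym: "sym (parcs ?T)" by (auto simp: parent_tree_def sym_def)
  have simple: "simple_graph ?T"
  proof (rule simple_graphI)
    show "(x, x) \<notin> parcs ?T" for x
      using par[of x] by (cases "0 < x \<and> x < n") (auto simp: parent_tree_def)
    show "finite (pverts ?T)" "pverts ?T \<noteq> {}" using n by (auto simp: parent_tree_def)
  qed (fact sub sym)+
  have "(x, y) \<in> (parcs ?T)\<^sup>*" if "x \<in> pverts ?T" "y \<in> pverts ?T" for x y
  proof -
    have "(x, y) \<in> (Restr (parcs ?T) {..<n})\<^sup>*"
      using that n par less_trans[OF par]
      by (intro parent_tree_connected[where t = 0]) (auto simp: parent_tree_def)
    then show ?thesis using rtrancl_mono[of "Restr (parcs ?T) {..<n}" "parcs ?T"] by blast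
  qed
  then have conn: "Digraph_Component.connected (with_proj ?T)"
    using connected_with_proj_iff[OF sym sub] n by (auto simp: parent_tree_def)
  have "False" if xs: "distinct xs" "3 \<le> length xs" "consecutive xs \<subseteq> parcs ?T"
    "(last xs, hd xs) \<in> parcs ?T" for xs
  proof -
    define m where "m = Max (set xs)"
    have "xs \<noteq> []" using xs(2) by auto
    then have "m \<in> set xs" by (simp add: m_def)
    then obtain a b where ab: "xs = a @ m # b" by (meson split_list)
    have le: "x \<le> m" if "x \<in> set xs" for x using that by (simp add: m_def)
    have ne: "b @ a \<noteq> []" using ab xs(2) by (cases a; cases b) auto
    \<comment> \<open>Rotated, the cycle is \<open>m # b @ a\<close>, so these are the two
      neighbours of \<open>m\<close>; length at least 3 makes them distinct.\<close>
    let ?c = "hd (b @ a)" and ?d = "last (b @ a)"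
    have lt: "x < m" if "x \<in> set (b @ a)" for x
      using that le[of x] xs(1) ab by (fastforce simp: le_less)
    have "2 \<le> length (b @ a)" using xs(2) ab by simp
    moreover have "distinct (b @ a)" using xs(1) ab by auto
    ultimately have cd: "?c \<noteq> ?d"
      by (cases "b @ a") (auto split: if_splits simp del: distinct_append)
    have "(m, ?c) \<in> parcs ?T"
      using xs(3,4) ab ne by (cases b) (auto simp: consecutive_append hd_append split: if_splits)
    moreover have "(?d, m) \<in> parcs ?T"
      using xs(3,4) ab ne by (cases a rule: rev_cases)
        (auto simp: consecutive_append hd_append split: if_splits)
    moreover have "y = par m" if "(m, y) \<in> parcs ?T \<or> (y, m) \<in> parcs ?T" "y < m" for y
      using that par[of y] par[of m]
      by (auto simp: parent_tree_def)
    ultimately show False using cd lt ne by (metis hd_in_set last_in_set)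
  qed
  then show ?thesis
    using long_cycle_iff[OF simple_graph_wf[OF simple]] simple conn unfolding is_tree_def by blast
qed

lemma decomposes_imp_tree_decomposition:
  assumes G: "simple_graph G" and td: "decomposes (parcs G) w R (pverts G) \<B>"
  shows "\<exists>T B. tree_decomposition G T B \<and> decomposition_width T B \<le> w"
proof -
  obtain n :: nat and par B where B: "0 < n" "pverts G = (\<Union>i<n. B i)"
    "\<And>i. i < n \<Longrightarrow> finite (B i) \<and> card (B i) \<le> w"
    "\<And>i. 0 < i \<Longrightarrow> i < n \<Longrightarrow> par i < i \<and> B i \<inter> (\<Union>j<i. B j) \<subseteq> B (par i)"
    "\<And>x y. x \<in> pverts G \<Longrightarrow> y \<in> pverts G \<Longrightarrow> (x, y) \<in> parcs G \<Longrightarrow> \<exists>i<n. x \<in> B i \<and> y \<in> B i"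
    using decomposes_indexed[OF td] by metis
  let ?T = "parent_tree n par"
  have sym: "sym (parcs ?T)" by (auto simp: parent_tree_def sym_def)
  have verts: "pverts ?T = {..<n}" by (simp add: parent_tree_def)
  have "Digraph_Component.connected (induce_subgraph (with_proj ?T) {t \<in> pverts ?T. v \<in> B t})"
    if v: "v \<in> pverts G" for v
  proof -
    let ?X = "{t \<in> pverts ?T. v \<in> B t}"
    \<comment> \<open>Bag \<open>t\<close> introduces \<open>v\<close>. Any other bag with
      \<open>v\<close> comes later and meets the earlier bags only inside its parent's bag, so the
      parent contains \<open>v\<close> too.\<close>
    define t where "t = (LEAST i. i < n \<and> v \<in> B i)"
    have ex: "\<exists>i. i < n \<and> v \<in> B i" using v B(2) by auto
    have t: "t < n" "v \<in> B t" using LeastI_ex[OF ex] by (auto simp: t_def)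
    have par: "0 < i \<and> par i \<in> ?X" if "i \<in> ?X" "i \<noteq> t" for i
    proof -
      have "t < i" using that Least_le[of "\<lambda>i. i < n \<and> v \<in> B i" i] by (auto simp: t_def verts)
      then have "v \<in> B (par i)" "par i < i" using t that B(4)[of i] by (auto simp: verts)
      then show ?thesis using that \<open>t < i\<close> by (auto simp: verts)
    qed
    have "\<forall>x\<in>?X. \<forall>y\<in>?X. (x, y) \<in> (Restr (parcs ?T) ?X)\<^sup>*"
      by (intro ballI parent_tree_connected[where t = t]) (use t par B(4) in \<open>auto simp: verts\<close>)
    then show ?thesis using connected_induce_iff[OF sym, of ?X] t by (auto simp: verts)
  qed
  moreover have "\<exists>t\<in>pverts ?T. u \<in> B t \<and> v \<in> B t" if "(u, v) \<in> parcs G" for u v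
    using B(5)[of u v] that simple_graph_arcs[OF G] by (auto simp: verts)
  ultimately have "tree_decomposition G ?T B"
    using parent_tree_is_tree[OF B(1), of par] B(2,4) by (auto simp: tree_decomposition_def verts)
  moreover have "decomposition_width ?T B \<le> w"
  proof -
    have "Max ((\<lambda>t. card (B t)) ` pverts ?T) \<le> w"
      using B(1,3) by (subst Max_le_iff) (auto simp: verts)
    then show ?thesis by (simp add: decomposition_width_def)
  qed
  ultimately show ?thesis by blast
qed

lemma decomposes_imp_treewidth:
  assumes "simple_graph G" "decomposes (parcs G) w R (pverts G) \<B>"
  shows "treewidth G \<le> w"
proof -
  obtain T B where "tree_decomposition G T B" "decomposition_width T B \<le> w"
    using decomposes_imp_tree_decomposition[OF assms] by blast
  moreover from this(1) have "treewidth G \<le> decomposition_width T B"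
    unfolding treewidth_def by (intro Least_le) blast
  ultimately show ?thesis by linarith
qed

text \<open>\<open>treewidth\<close> is a \<open>LEAST\<close>; the single bag
  \<open>pverts G\<close> shows that there is a width to choose from.\<close>

lemma treewidth_attained:
  assumes "simple_graph G"
  shows "\<exists>T B. tree_decomposition G T B \<and> decomposition_width T B = treewidth G"
proof -
  have "decomposes (parcs G) (card (pverts G)) (pverts G) (pverts G) {pverts G}"
    by (rule decomposes.start) (simp_all add: simple_graph_finite[OF assms])
  then have "\<exists>w T B. tree_decomposition G T B \<and> decomposition_width T B = w"
    using decomposes_imp_tree_decomposition[OF assms] by blast
  then show ?thesis unfolding treewidth_def by (rule LeastI_ex)
qed

section \<open>Components and long paths\<close>

definition component :: "'a rel \<Rightarrow> 'a set \<Rightarrow> 'a \<Rightarrow> 'a set" where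
  "component E Y x = (Restr E Y)\<^sup>* `` {x}"

lemma component_self: "x \<in> component E Y x"
  by (simp add: component_def)

lemma component_subset: "x \<in> Y \<Longrightarrow> component E Y x \<subseteq> Y"
proof
  fix y assume "x \<in> Y" "y \<in> component E Y x"
  then have "(x, y) \<in> (Restr E Y)\<^sup>*" by (simp add: component_def)
  then show "y \<in> Y" using \<open>x \<in> Y\<close> by induction auto
qed

lemma component_eq:
  assumes "sym E" "y \<in> component E Y x"
  shows "component E Y y = component E Y x"
proof -
  have "sym ((Restr E Y)\<^sup>*)" using assms(1) by (intro sym_rtrancl) (auto simp: sym_def)
  then have "(x, y) \<in> (Restr E Y)\<^sup>*" "(y, x) \<in> (Restr E Y)\<^sup>*"
    using assms(2) by (auto simp: component_def dest: symD)
  then show ?thesis by (auto simp: component_def intro: rtrancl_trans)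
qed

lemma component_closed:
  "y \<in> component E Y x \<Longrightarrow> (y, z) \<in> E \<Longrightarrow> y \<in> Y \<Longrightarrow> z \<in> Y \<Longrightarrow> z \<in> component E Y x"
  by (auto simp: component_def intro: rtrancl.rtrancl_into_rtrancl)

text \<open>A walk inside \<open>Y\<close> never leaves the component, so it is already a walk
  inside the component.\<close>

lemma component_connected:
  assumes "sym E" "y \<in> component E Y x" "z \<in> component E Y x"
  shows "(y, z) \<in> (Restr E (component E Y x))\<^sup>*"
proof -
  have "(y, z) \<in> (Restr E Y)\<^sup>*"
    using assms component_eq[OF assms(1,2)] by (auto simp: component_def)
  then show ?thesis
  proof (induction rule: rtrancl_induct)
    case (step u v)
    then have "u \<in> component E Y x" "v \<in> component E Y x"
      using component_eq[OF assms(1,2)]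
      by (auto simp: component_def intro: rtrancl.rtrancl_into_rtrancl)
    then show ?case using step by (auto intro: rtrancl.rtrancl_into_rtrancl)
  qed simp
qed

text \<open>Different components of \<open>U - U0\<close> are disjoint and have no edges between
  them, so each is glued on separately. Its attachment set \<open>N\<close> must lie in a bag of the
  initial decomposition, which stays available throughout, and in the start bag of the component's
  own decomposition.\<close>

lemma decomposes_attach_components:
  assumes "sym E" "finite U" "decomposes E w R U0 \<B>0" "U0 \<subseteq> U"
    and comp: "\<And>x. x \<in> U - U0 \<Longrightarrow> \<exists>N B R' \<B>'. B \<in> \<B>0 \<and> N \<subseteq> B \<and> N \<subseteq> U0 \<and> N \<subseteq> R' \<and>
      (\<forall>y\<in>component E (U - U0) x. \<forall>z\<in>U0. (y, z) \<in> E \<longrightarrow> z \<in> N) \<and>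
      decomposes E w R' (component E (U - U0) x \<union> N) \<B>'"
  shows "\<exists>\<B>. decomposes E w R U \<B>"
proof -
  let ?C = "component E (U - U0)"
  have "\<exists>\<B>. \<B>0 \<subseteq> \<B> \<and> decomposes E w R (U0 \<union> (\<Union>x\<in>X. ?C x)) \<B>" if "finite X" "X \<subseteq> U - U0" for X
    using that
  proof (induction X rule: finite_induct)
    case empty
    then show ?case using assms(3) by auto
  next
    case (insert x X)
    let ?V = "U0 \<union> (\<Union>x\<in>X. ?C x)"
    obtain \<B> where \<B>: "\<B>0 \<subseteq> \<B>" "decomposes E w R ?V \<B>" using insert by auto
    have x: "x \<in> U - U0" using insert by blast
    have sub: "?C y \<subseteq> U - U0" if "y \<in> insert x X" for y
      using component_subset[of y "U - U0" E] that insert.prems by blast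
    show ?case
    \<comment> \<open>Several \<open>x\<close> name the same component, which is attached only
      once.\<close>
    proof (cases "\<exists>y\<in>X. x \<in> ?C y")
      case True
      then obtain y where "y \<in> X" "?C x = ?C y" using component_eq[OF assms(1)] by blast
      then have "U0 \<union> (\<Union>x\<in>insert x X. ?C x) = ?V" by auto
      then show ?thesis using \<B> by auto
    next
      case False
      have disj: "?C x \<inter> ?C y = {}" if "y \<in> X" for y
      proof (rule ccontr)
        assume "?C x \<inter> ?C y \<noteq> {}"
        then have "?C x = ?C y" using component_eq[OF assms(1)] by blast
        then show False using False component_self[of x E "U - U0"] that by blast
      qed
      obtain N B R' \<B>' where N: "B \<in> \<B>0" "N \<subseteq> B" "N \<subseteq> U0" "N \<subseteq> R'"
        "\<And>y z. y \<in> ?C x \<Longrightarrow> z \<in> U0 \<Longrightarrow> (y, z) \<in> E \<Longrightarrow> z \<in> N"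
        "decomposes E w R' (?C x \<union> N) \<B>'"
        using comp[OF x] by metis
      have R': "R' \<subseteq> ?C x \<union> N" using decomposes_start[OF N(6)] by blast
      have Vx: "?V \<inter> ?C x = {}" using disj sub by blast
      have "\<exists>\<B>''. \<B> \<subseteq> \<B>'' \<and> decomposes E w R (?V \<union> (?C x \<union> N)) \<B>''"
      proof (rule decomposes_join[OF N(6) \<B>(2)])
        show "B \<in> \<B>" using N(1) \<B>(1) by blast
        show "?V \<inter> R' \<subseteq> B" using R' Vx N(2) by blast
        show "?V \<inter> (?C x \<union> N) \<subseteq> R'" using Vx N(4) by blast
        fix y z assume yz: "y \<in> ?C x \<union> N - ?V" "z \<in> ?V - (?C x \<union> N)"
        then have y: "y \<in> ?C x" using N(3) by blast
        have "(y, z) \<notin> E"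
        proof
          assume e: "(y, z) \<in> E"
          show False
          proof (cases "z \<in> U0")
            case True
            then show False using N(5)[OF y] e yz by blast
          next
            case False
            then have "z \<in> ?C x"
              using yz sub y e by (intro component_closed[OF y e]) blast+
            then show False using yz by blast
          qed
        qed
        then show "(y, z) \<notin> E \<and> (z, y) \<notin> E" using assms(1) by (auto dest: symD)
      qed
      moreover have "?V \<union> (?C x \<union> N) = U0 \<union> (\<Union>x\<in>insert x X. ?C x)" using N(3) by auto
      ultimately show ?thesis using \<B>(1) by (metis order_trans)
    qed
  qed
  from this[of "U - U0"] obtain \<B> where "decomposes E w R (U0 \<union> (\<Union>x\<in>U - U0. ?C x)) \<B>"
    using assms(2) by auto
  moreover have "U0 \<union> (\<Union>x\<in>U - U0. ?C x) = U"
    using assms(4) component_subset[of _ "U - U0" E] component_self[of _ E "U - U0"] by blast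
  ultimately show ?thesis by auto
qed

section \<open>Paths as lists of distinct vertices\<close>

definition path_in :: "'a rel \<Rightarrow> 'a set \<Rightarrow> 'a list \<Rightarrow> bool" where
  "path_in E U xs \<longleftrightarrow> distinct xs \<and> consecutive xs \<subseteq> E \<and> set xs \<subseteq> U"

lemma path_in_rev: "sym E \<Longrightarrow> path_in E U (rev xs) \<longleftrightarrow> path_in E U xs"
  by (auto simp: path_in_def consecutive_rev dest: symD)

lemma path_in_append:
  "path_in E U (xs @ ys) \<longleftrightarrow> path_in E U xs \<and> path_in E U ys \<and> set xs \<inter> set ys = {} \<and>
    (xs = [] \<or> ys = [] \<or> (last xs, hd ys) \<in> E)"
  by (auto simp: path_in_def consecutive_append)

lemma path_in_take: "path_in E U xs \<Longrightarrow> path_in E U (take n xs)"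
  by (metis append_take_drop_id path_in_append)

text \<open>Whenever the walk returns to a listed vertex, the list is cut back to it.\<close>

lemma rtrancl_imp_path_in:
  assumes "(x, y) \<in> (Restr E C)\<^sup>*" "x \<in> C"
  shows "\<exists>xs. path_in E C xs \<and> xs \<noteq> [] \<and> hd xs = x \<and> last xs = y"
  using assms(1)
proof (induction rule: rtrancl_induct)
  case base
  then show ?case using assms(2) by (intro exI[of _ "[x]"]) (auto simp: path_in_def)
next
  case (step y z)
  then obtain xs where xs: "path_in E C xs" "xs \<noteq> []" "hd xs = x" "last xs = y" by blast
  show ?case
  proof (cases "z \<in> set xs")
    case True
    then obtain a b where ab: "xs = a @ z # b" by (meson split_list)
    then have "path_in E C (a @ [z])" using xs(1) path_in_append[of E C "a @ [z]" b] by simp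
    then show ?thesis using xs ab by (intro exI[of _ "a @ [z]"]) (auto simp: hd_append)
  next
    case False
    then have "path_in E C (xs @ [z])"
      using xs step(2) by (auto simp: path_in_append) (auto simp: path_in_def)
    then show ?thesis using xs by (intro exI[of _ "xs @ [z]"]) auto
  qed
qed

text \<open>This bounds treewidth by treedepth, as in a depth-first search. After deletion of
  \<open>c\<close> every component contains a neighbour \<open>c'\<close> of \<open>c\<close>. A
  path from \<open>c'\<close> inside the component can be prolonged by \<open>c\<close>, so the
  bound drops by one, and \<open>c\<close> is then added to all bags of the component.\<close>

lemma decomposes_bounded_paths:
  assumes "sym E" "finite U" "c \<in> U" "\<And>x. x \<in> U \<Longrightarrow> (c, x) \<in> (Restr E U)\<^sup>*"
    and "\<And>xs. path_in E U xs \<Longrightarrow> xs \<noteq> [] \<Longrightarrow> hd xs = c \<Longrightarrow> length xs \<le> k"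
  shows "\<exists>\<B>. decomposes E k {c} U \<B>"
  using assms(2-)
proof (induction k arbitrary: c U)
  case 0
  have "path_in E U [c]" using 0 by (simp add: path_in_def)
  then show ?case using 0(4)[of "[c]"] by simp
next
  case (Suc k)
  show ?case
  proof (rule decomposes_attach_components[OF assms(1) Suc.prems(1)])
    show "decomposes E (Suc k) {c} {c} {{c}}" by (rule decomposes.start) auto
    show "{c} \<subseteq> U" using Suc.prems by simp
    fix x assume x: "x \<in> U - {c}"
    let ?C = "component E (U - {c}) x"
    \<comment> \<open>On a walk from \<open>c\<close>, a step out of \<open>c\<close> lands on a
      neighbour of \<open>c\<close>, and further steps that avoid \<open>c\<close> stay in one
      component.\<close>
    have "x \<noteq> c \<longrightarrow> (\<exists>c'\<in>component E (U - {c}) x. (c, c') \<in> E)"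
      if "(c, x) \<in> (Restr E U)\<^sup>*" for x
      using that
    proof (induction rule: rtrancl_induct)
      case (step y z)
      show ?case
      proof
        assume "z \<noteq> c"
        show "\<exists>c'\<in>component E (U - {c}) z. (c, c') \<in> E"
        proof (cases "y = c")
          case True
          then show ?thesis using step component_self[of z] by blast
        next
          case False
          then have "z \<in> component E (U - {c}) y"
            using step \<open>z \<noteq> c\<close> component_self[of y E "U - {c}"] by (auto intro: component_closed)
          then show ?thesis using step False component_eq[OF assms(1)] by blast
        qed
      qed
    qed simp
    then obtain c' where c': "c' \<in> ?C" "(c, c') \<in> E" using x Suc.prems(3)[of x] by blast
    have sub: "?C \<subseteq> U - {c}" by (rule component_subset) (use x in simp)
    have "\<exists>\<B>. decomposes E k {c'} ?C \<B>"
    proof (rule Suc.IH)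
      show "finite ?C" using sub Suc.prems(1) by (meson finite_Diff finite_subset)
      show "c' \<in> ?C" by fact
      show "(c', y) \<in> (Restr E ?C)\<^sup>*" if "y \<in> ?C" for y
        by (rule component_connected[OF assms(1) c'(1) that])
      fix xs assume xs: "path_in E ?C xs" "xs \<noteq> []" "hd xs = c'"
      then have "path_in E U (c # xs)"
        using sub c'(2) Suc.prems(2) by (auto simp: path_in_def consecutive_Cons)
      then show "length xs \<le> k" using Suc.prems(4)[of "c # xs"] by simp
    qed
    then obtain \<B> where "decomposes E k {c'} ?C \<B>" by blast
    then have "decomposes E (k + 1) ({c'} \<union> {c}) (?C \<union> {c}) ((\<union>) {c} ` \<B>)"
      by (rule decomposes_Un) auto
    then show "\<exists>N B R' \<B>'. B \<in> {{c}} \<and> N \<subseteq> B \<and> N \<subseteq> {c} \<and> N \<subseteq> R' \<and>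
      (\<forall>y\<in>?C. \<forall>z\<in>{c}. (y, z) \<in> E \<longrightarrow> z \<in> N) \<and> decomposes E (Suc k) R' (?C \<union> N) \<B>'"
      by (intro exI[of _ "{c}"] exI[of _ "{c}"] exI[of _ "{c'} \<union> {c}"] exI[of _ "(\<union>) {c} ` \<B>"]) auto
  qed
qed

section \<open>Spiders and the chords that create them\<close>

definition spider :: "'a rel \<Rightarrow> nat \<Rightarrow> 'a set \<Rightarrow> bool" where
  "spider E k U \<longleftrightarrow> (\<exists>c p q r. distinct (c # p @ q @ r) \<and> set (c # p @ q @ r) \<subseteq> U \<and>
     length p = k \<and> length q = k \<and> length r = k \<and>
     consecutive (c # p) \<subseteq> E \<and> consecutive (c # q) \<subseteq> E \<and> consecutive (c # r) \<subseteq> E)"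

text \<open>Longer legs are cut down to \<open>k\<close> vertices.\<close>

lemma spiderI:
  assumes "path_in E U (c # p)" "path_in E U (c # q)" "path_in E U (c # r)"
    and "set p \<inter> set q = {}" "set p \<inter> set r = {}" "set q \<inter> set r = {}"
    and "k \<le> length p" "k \<le> length q" "k \<le> length r"
  shows "spider E k U"
proof -
  have "path_in E U (c # take k p)" "path_in E U (c # take k q)" "path_in E U (c # take k r)"
    using assms(1-3)[THEN path_in_take, of "Suc k"] by auto
  moreover have "set (take k p) \<inter> set (take k q) = {}" "set (take k p) \<inter> set (take k r) = {}"
    "set (take k q) \<inter> set (take k r) = {}"
    using assms(4-6) set_take_subset[of k p] set_take_subset[of k q] set_take_subset[of k r] by blast+
  ultimately show ?thesis
    using assms(7-9) unfolding spider_def path_in_def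
    by (intro exI[of _ c] exI[of _ "take k p"] exI[of _ "take k q"] exI[of _ "take k r"]) auto
qed

lemma spider_mono:
  assumes "spider E k X" "X \<subseteq> U"
  shows "spider E k U"
proof -
  obtain c p q r where "distinct (c # p @ q @ r)" "set (c # p @ q @ r) \<subseteq> X"
    "length p = k" "length q = k" "length r = k"
    "consecutive (c # p) \<subseteq> E" "consecutive (c # q) \<subseteq> E" "consecutive (c # r) \<subseteq> E"
    using assms(1) unfolding spider_def by blast
  then show ?thesis
    using assms(2) unfolding spider_def
    by (intro exI[of _ c] exI[of _ p] exI[of _ q] exI[of _ r]) auto
qed

text \<open>The spider is centred at \<open>P ! i\<close>. One leg runs back along \<open>P\<close>,
  one runs forward, and the third passes through \<open>ys\<close> to \<open>P ! j\<close> and then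
  returns along \<open>P\<close> towards the centre. At least \<open>2 * k - 1\<close> vertices lie
  between the two positions: \<open>k\<close> for the forward leg and \<open>k - 1\<close> for the
  third, which also has \<open>P ! j\<close>. Empty \<open>ys\<close> is the case of a
  chord.\<close>

lemma chord_imp_spider_aux:
  assumes E: "sym E" and P: "path_in E U P" and ys: "path_in E U ys" "set ys \<inter> set P = {}"
    "consecutive (P ! i # ys @ [P ! j]) \<subseteq> E"
    and k: "0 < k" "k \<le> i" "i + 2 * k \<le> j" "j < length P"
  shows "spider E k U"
proof -
  define l r where "l = take i P" and "r = drop (Suc i) P"
  define m where "m = j - Suc i"
  let ?x = "P ! i" and ?y = "P ! j"
  have Pl: "P = l @ ?x # r" using k by (simp add: l_def r_def id_take_nth_drop)
  have y: "r ! m = ?y" "m < length r" using k by (auto simp: r_def m_def)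
  \<comment> \<open>This splits the stretch strictly between the two positions: \<open>r0\<close> is
    the forward leg, \<open>rev r1\<close> the final part of the third leg.\<close>
  define r0 r1 where "r0 = take k (take m r)" and "r1 = drop k (take m r)"
  have "r = take m r @ ?y # drop (Suc m) r" using y id_take_nth_drop[of m r] by simp
  then have r: "r = r0 @ r1 @ ?y # drop (Suc m) r"
    by (metis append.assoc append_take_drop_id r0_def r1_def)
  define t where "t = drop (Suc m) r"
  have Pd: "P = l @ ?x # r0 @ r1 @ ?y # t" using Pl r t_def by simp
  have len: "k \<le> length l" "length r0 = k" "k \<le> Suc (length r1)"
    using k y by (auto simp: l_def r0_def r1_def m_def)
  define x y where "x = ?x" and "y = ?y"
  have P': "path_in E U (l @ x # r0 @ r1 @ y # t)" and ysP: "set ys \<inter> set (l @ x # r0 @ r1 @ y # t) = {}"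
    and ysc: "consecutive (x # ys @ [y]) \<subseteq> E"
    using P ys Pd x_def y_def by metis+
  have "path_in E U (rev (l @ [x]))"
    using P' path_in_append[of E U "l @ [x]" "r0 @ r1 @ y # t"] path_in_rev[OF E] by (metis append.assoc append_Cons append_Nil)
  then have 1: "path_in E U (x # rev l)" by simp
  have "path_in E U (x # r0 @ r1 @ y # t)" using P' path_in_append by blast
  then have 2: "path_in E U (x # r0)" using path_in_append[of E U "x # r0" "r1 @ y # t"] by simp
  have "path_in E U (r1 @ y # t)"
    using P' path_in_append[of E U "l @ x # r0" "r1 @ y # t"] by simp
  then have "path_in E U (r1 @ [y])" using path_in_append[of E U "r1 @ [y]" t] by simp
  then have "path_in E U (y # rev r1)" using path_in_rev[OF E, of U "r1 @ [y]"] by simp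
  moreover have "path_in E U (x # ys)" "ys \<noteq> [] \<longrightarrow> (last ys, y) \<in> E" "ys = [] \<longrightarrow> (x, y) \<in> E"
    using ys(1) ysP ysc P' by (auto simp: path_in_def consecutive_Cons consecutive_append split: if_splits)
  moreover have "set (x # ys) \<inter> set (y # rev r1) = {}"
    using ysP P' by (auto simp: path_in_def)
  ultimately have 3: "path_in E U (x # ys @ y # rev r1)"
    using path_in_append[of E U "x # ys" "y # rev r1"] by auto
  show ?thesis
    by (rule spiderI[OF 1 2 3]) (use P' ysP len in \<open>auto simp: path_in_def\<close>)
qed

text \<open>If \<open>j\<close> precedes \<open>i\<close>, the path is reversed. Therefore
  \<open>i\<close> needs \<open>k\<close> path vertices on both sides, whereas \<open>j\<close> only
  has to be far from \<open>i\<close>.\<close>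

lemma chord_imp_spider:
  assumes E: "sym E" and P: "path_in E U P" and ys: "path_in E U ys" "set ys \<inter> set P = {}"
    "consecutive (P ! i # ys @ [P ! j]) \<subseteq> E"
    and k: "0 < k" "k \<le> i" "i + k < length P" "j < length P" "i + 2 * k \<le> j \<or> j + 2 * k \<le> i"
  shows "spider E k U"
proof (cases "i + 2 * k \<le> j")
  case True
  then show ?thesis using chord_imp_spider_aux[OF E P ys] k by simp
next
  case False
  let ?n = "length P"
  have nth: "rev P ! (?n - Suc i) = P ! i" "rev P ! (?n - Suc j) = P ! j"
    using k by (auto simp: rev_nth)
  show ?thesis
    by (rule chord_imp_spider_aux[of E U "rev P" ys "?n - Suc i" "?n - Suc j"])
      (use E P ys k False in \<open>auto simp: path_in_rev nth\<close>)
qed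

section \<open>Graphs without spiders\<close>

lemma longest_path_exists:
  assumes "finite U"
  shows "\<exists>P. path_in E U P \<and> (\<forall>Q. path_in E U Q \<longrightarrow> length Q \<le> length P)"
proof -
  have "length Q \<le> card U" if "path_in E U Q" for Q
    using that assms by (metis card_mono distinct_card path_in_def)
  then show ?thesis
    using ex_has_greatest_nat[of "path_in E U" "[]" length "Suc (card U)"]
    by (auto simp: path_in_def less_Suc_eq_le)
qed

definition path_ends :: "nat \<Rightarrow> 'a list \<Rightarrow> 'a set" where
  "path_ends k P = {P ! j |j. j < length P \<and> (j < k \<or> length P \<le> j + k)}"

text \<open>Without spiders, a chord with at least one endpoint outside the ends spans fewer than
  \<open>2 * k\<close> positions, so a window of this length can contain both endpoints.\<close>

definition path_window :: "nat \<Rightarrow> 'a list \<Rightarrow> nat \<Rightarrow> 'a set" where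
  "path_window k P i = path_ends k P \<union> {P ! j |j. j < length P \<and> i \<le> j \<and> j < i + 2 * k}"

lemma path_window_finite: "finite (path_window k P i)"
  by (rule finite_subset[of _ "set P"]) (auto simp: path_window_def path_ends_def)

lemma path_window_card: "card (path_window k P i) \<le> 4 * k"
proof -
  let ?n = "length P"
  have "path_window k P i \<subseteq> (!) P ` ({..<k} \<union> {?n - k..<?n} \<union> {i..<i + 2 * k})"
    by (auto simp: path_window_def path_ends_def)
  then have "card (path_window k P i) \<le> card ({..<k} \<union> {?n - k..<?n} \<union> {i..<i + 2 * k})"
    by (meson finite_UnI finite_lessThan finite_atLeastLessThan surj_card_le)
  also have "\<dots> \<le> card {..<k} + card {?n - k..<?n} + card {i..<i + 2 * k}"
    by (meson add_mono card_Un_le le_refl order_trans)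
  also have "\<dots> \<le> 4 * k" by simp
  finally show ?thesis .
qed

text \<open>The window advances by one position at a time. A vertex that it newly reaches is at
  least \<open>2 * k\<close> positions beyond every vertex left behind, so an edge between them
  would give a spider. The bound \<open>5 * k\<close> exceeds the size of a window because the
  components attached later need it.\<close>

lemma decomposes_path:
  assumes E: "sym E" and k: "0 < k" and P: "path_in E U P" and nsp: "\<not> spider E k U"
  shows "\<exists>\<B>. decomposes E (5 * k) (path_window k P 0) (set P) \<B> \<and> (\<forall>i \<le> length P. path_window k P i \<in> \<B>)"
proof -
  let ?n = "length P" and ?W = "path_window k P"
  \<comment> \<open>What the windows \<open>0\<close> to \<open>i\<close> cover together.\<close>
  let ?V = "\<lambda>i. path_ends k P \<union> {P ! j |j. j < ?n \<and> j < i + 2 * k}"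
  have inj: "a = b" if "P ! a = P ! b" "a < ?n" "b < ?n" for a b
    using P that by (auto simp: path_in_def nth_eq_iff_index_eq)
  have td: "decomposes E (5 * k) (?W 0) (?V i) (?W ` {..i})" for i
  proof (induction i)
    case 0
    have "?V 0 = ?W 0" by (auto simp: path_window_def)
    moreover have "decomposes E (5 * k) (?W 0) (?W 0) {?W 0}"
      using path_window_card[of k P 0] path_window_finite[of k P 0] by (intro decomposes.start) auto
    ultimately show ?case by simp
  next
    case (Suc i)
    have "decomposes E (5 * k) (?W 0) (?V i \<union> ?W (Suc i)) (insert (?W (Suc i)) (?W ` {..i}))"
    proof (rule decomposes.add_bag[OF Suc])
      show "?W i \<in> ?W ` {..i}" by simp
      show "finite (?W (Suc i))" by (rule path_window_finite)
      show "card (?W (Suc i)) \<le> 5 * k" using path_window_card[of k P "Suc i"] by simp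
      show "?W (Suc i) \<inter> ?V i \<subseteq> ?W i"
        by (auto simp: path_window_def dest: inj)
      fix x y assume xy: "x \<in> ?W (Suc i) - ?V i" "y \<in> ?V i - ?W (Suc i)"
      then obtain a where a: "x = P ! a" "a < ?n" "i + 2 * k \<le> a" "x \<notin> path_ends k P"
        by (auto simp: path_window_def not_less)
      obtain b where "y = P ! b" "b < ?n" "b < i + 2 * k" "P ! b \<notin> ?W (Suc i)"
        using xy(2) by (auto simp: path_window_def)
      moreover have "P ! b \<in> ?W (Suc i)" if "Suc i \<le> b" "b < i + 2 * k" "b < ?n"
        using that by (auto simp: path_window_def)
      ultimately have b: "y = P ! b" "b < ?n" "b \<le> i" by (auto simp: not_less_eq_eq[symmetric])
      have ak: "k \<le> a" "a + k < ?n" using a by (force simp: path_ends_def)+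
      have "(x, y) \<notin> E"
      proof
        assume "(x, y) \<in> E"
        then have "spider E k U"
          using chord_imp_spider[OF E P, of "[]" a b k] k ak a b by (simp add: path_in_def)
        then show False using nsp by simp
      qed
      then show "(x, y) \<notin> E \<and> (y, x) \<notin> E" using E by (auto dest: symD)
    qed
    moreover have "?V i \<union> ?W (Suc i) = ?V (Suc i)"
    proof
      have "j < i + 2 * k \<or> Suc i \<le> j \<and> j < Suc i + 2 * k" if "j < Suc i + 2 * k" for j
        using that k by linarith
      then show "?V (Suc i) \<subseteq> ?V i \<union> ?W (Suc i)"
        by (auto simp: path_window_def)
    qed (auto simp: path_window_def)
    ultimately show ?case by (simp add: atMost_Suc)
  qed
  have "?V ?n = set P"
    using k by (auto simp: path_ends_def in_set_conv_nth)
  then have "decomposes E (5 * k) (?W 0) (set P) (?W ` {..?n})" using td[of ?n] by simp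
  then show ?thesis by (intro exI[of _ "?W ` {..?n}"]) auto
qed

text \<open>The induction hypothesis serves only components without neighbours on \<open>P\<close>.
  Any other component has bags of size \<open>k\<close> by the bound on its paths, and a window of
  size at most \<open>4 * k\<close> that contains all its neighbours on \<open>P\<close> is added to
  them.\<close>

lemma no_spider_decomposes:
  assumes E: "sym E" and k: "0 < k" and "finite U" "\<not> spider E k U"
  shows "\<exists>R \<B>. decomposes E (5 * k) R U \<B>"
  using assms(3,4)
proof (induction "card U" arbitrary: U rule: less_induct)
  case less
  show ?case
  proof (cases "U = {}")
    case True
    have "decomposes E (5 * k) {} {} {{}}" by (rule decomposes.start) auto
    then show ?thesis using True by blast
  next
    case False
    obtain P where P: "path_in E U P" and longest: "\<And>Q. path_in E U Q \<Longrightarrow> length Q \<le> length P"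
      using longest_path_exists[OF less.prems(1)] by blast
    let ?n = "length P" and ?W = "path_window k P" and ?Y = "U - set P"
    obtain u where "u \<in> U" using False by blast
    then have "P \<noteq> []" using longest[of "[u]"] by (auto simp: path_in_def)
    have PU: "set P \<subseteq> U" using P by (simp add: path_in_def)
    have inj: "a = b" if "P ! a = P ! b" "a < ?n" "b < ?n" for a b
      using P that by (auto simp: path_in_def nth_eq_iff_index_eq)
    obtain \<B>0 where \<B>0: "decomposes E (5 * k) (?W 0) (set P) \<B>0" "\<And>i. i \<le> ?n \<Longrightarrow> ?W i \<in> \<B>0"
      using decomposes_path[OF E k P less.prems(2)] by blast
    have "\<exists>\<B>. decomposes E (5 * k) (?W 0) U \<B>"
    proof (rule decomposes_attach_components[OF E less.prems(1) \<B>0(1) PU])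
      fix x assume x: "x \<in> ?Y"
      let ?C = "component E ?Y x"
      let ?N = "{y \<in> set P. \<exists>z\<in>?C. (z, y) \<in> E}"
      have CY: "?C \<subseteq> ?Y" by (rule component_subset) fact
      have finC: "finite ?C" using CY less.prems(1) by (meson finite_Diff finite_subset)
      show "\<exists>N B R' \<B>'. B \<in> \<B>0 \<and> N \<subseteq> B \<and> N \<subseteq> set P \<and> N \<subseteq> R' \<and>
        (\<forall>y\<in>?C. \<forall>z\<in>set P. (y, z) \<in> E \<longrightarrow> z \<in> N) \<and> decomposes E (5 * k) R' (?C \<union> N) \<B>'"
      proof (cases "?N = {}")
        case True
        have "card ?C < card U"
        proof (rule psubset_card_mono[OF less.prems(1)])
          have "hd P \<in> set P" using \<open>P \<noteq> []\<close> by simp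
          then show "?C \<subset> U" using CY PU by blast
        qed
        moreover have "\<not> spider E k ?C" using less.prems(2) spider_mono[of E k ?C U] CY by blast
        ultimately obtain R' \<B>' where "decomposes E (5 * k) R' ?C \<B>'"
          using less.hyps finC by blast
        then show ?thesis using True \<B>0(2)[of 0]
          by (intro exI[of _ "{}"] exI[of _ "?W 0"] exI[of _ R'] exI[of _ \<B>']) auto
      next
        case False
        then obtain y z where yz: "y \<in> set P" "z \<in> ?C" "(z, y) \<in> E" by blast
        then obtain i where i: "i < ?n" "P ! i = y" by (auto simp: in_set_conv_nth)
        have "\<exists>\<B>. decomposes E k {z} ?C \<B>"
        proof (rule decomposes_bounded_paths[OF E finC yz(2)])
          show "(z, v) \<in> (Restr E ?C)\<^sup>*" if "v \<in> ?C" for v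
            by (rule component_connected[OF E yz(2) that])
          fix xs assume xs: "path_in E ?C xs" "xs \<noteq> []" "hd xs = z"
          define l r where "l = take i P" and "r = drop (Suc i) P"
          have Pl: "P = l @ y # r" using i by (auto simp: l_def r_def id_take_nth_drop)
          have yx: "(y, hd xs) \<in> E" using yz(3) E xs(3) by (auto dest: symD)
          have disj: "set xs \<inter> set P = {}" and xsU: "path_in E U xs"
            using xs(1) CY by (auto simp: path_in_def)
          have Pr: "path_in E U (l @ [y])" "path_in E U (y # r)"
            using P Pl path_in_append[of E U "l @ [y]" r] path_in_append[of E U l "y # r"] by auto
          have yxs: "path_in E U (y # xs)"
            using path_in_append[of E U "[y]" xs] yx disj Pl xsU Pr(2) path_in_append[of E U "[y]" r] by auto
          show "length xs \<le> k"
          proof (rule ccontr)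
            \<comment> \<open>Replacing either side of \<open>P\<close> at \<open>y\<close> by
              \<open>xs\<close> gives a path, so by maximality both \<open>l\<close> and
              \<open>r\<close> are at least as long as \<open>xs\<close>. Then \<open>y\<close> is
              the centre of a spider with legs in \<open>l\<close>, \<open>r\<close> and
              \<open>xs\<close>.\<close>
            assume "\<not> length xs \<le> k"
            then have long: "k < length xs" by simp
            have "path_in E U ((l @ [y]) @ xs)"
              using path_in_append[of E U "l @ [y]" xs] Pr(1) xsU yx disj Pl by auto
            then have "length l + 1 + length xs \<le> ?n" using longest by fastforce
            then have "k \<le> length r" using long Pl by simp
            have "path_in E U (rev (y # xs))" using yxs path_in_rev[OF E] by blast
            then have "path_in E U ((rev xs @ [y]) @ r)"
              using path_in_append[of E U "rev xs @ [y]" r] path_in_append[of E U "[y]" r] Pr(2) disj Pl P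
              by (auto simp: path_in_def)
            then have "length xs + 1 + length r \<le> ?n" using longest by fastforce
            then have "k \<le> length l" using long Pl by simp
            have "path_in E U (y # rev l)"
              using path_in_rev[OF E, of U "l @ [y]"] Pr(1) by simp
            then have "spider E k U"
              by (rule spiderI[OF _ Pr(2) yxs])
                (use \<open>k \<le> length l\<close> \<open>k \<le> length r\<close> long disj Pl P in \<open>auto simp: path_in_def\<close>)
            then show False using less.prems(2) by simp
          qed
        qed
        then obtain \<B> where \<B>: "decomposes E k {z} ?C \<B>" by blast
        have "\<exists>i0 \<le> ?n. ?N \<subseteq> ?W i0"
        proof (cases "?N \<subseteq> path_ends k P")
          case True
          then show ?thesis by (intro exI[of _ 0]) (auto simp: path_window_def)
        next
          case ends: False
          let ?J = "\<lambda>i. i < ?n \<and> k \<le> i \<and> i + k < ?n \<and> P ! i \<in> ?N"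
          have J: "\<exists>i. v = P ! i \<and> ?J i" if "v \<in> ?N" "v \<notin> path_ends k P" for v
          proof -
            have "v \<in> set P" using that(1) by blast
            then obtain i where "i < ?n" "P ! i = v" by (auto simp: in_set_conv_nth)
            then show ?thesis using that by (intro exI[of _ i]) (auto simp: path_ends_def not_less not_le)
          qed
          \<comment> \<open>The leftmost neighbour outside the ends. Any other one is fewer than
            \<open>2 * k\<close> positions to its right, since a path through the component is a
            detour between the two.\<close>
          define i0 where "i0 = (LEAST i. ?J i)"
          have "\<exists>i. ?J i" using J ends by blast
          then have i0: "?J i0" unfolding i0_def by (rule LeastI_ex)
          have "v \<in> ?W i0" if v: "v \<in> ?N" for v
          proof (cases "v \<in> path_ends k P")
            case True
            then show ?thesis by (simp add: path_window_def)
          next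
            case False
            then obtain j where j: "v = P ! j" "?J j" using J v by blast
            have "i0 \<le> j" unfolding i0_def by (rule Least_le) (use j in blast)
            have "j < i0 + 2 * k"
            proof (rule ccontr)
              assume "\<not> j < i0 + 2 * k"
              obtain a b where ab: "a \<in> ?C" "(a, P ! i0) \<in> E" "b \<in> ?C" "(b, P ! j) \<in> E"
                using i0 j by blast
              obtain ys where ys: "path_in E ?C ys" "ys \<noteq> []" "hd ys = a" "last ys = b"
                using rtrancl_imp_path_in[OF component_connected[OF E ab(1,3)] ab(1)] by blast
              have "spider E k U"
              proof (rule chord_imp_spider[OF E P, of ys i0 j])
                show "path_in E U ys" "set ys \<inter> set P = {}" using ys(1) CY by (auto simp: path_in_def)
                show "consecutive (P ! i0 # ys @ [P ! j]) \<subseteq> E"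
                  using ys ab E
                  by (auto simp: consecutive_Cons consecutive_append path_in_def dest: symD)
              qed (use k i0 j \<open>\<not> j < i0 + 2 * k\<close> in auto)
              then show False using less.prems(2) by simp
            qed
            then show ?thesis using \<open>i0 \<le> j\<close> j by (auto simp: path_window_def)
          qed
          then show ?thesis using i0 by (intro exI[of _ i0]) auto
        qed
        then obtain i0 where i0: "i0 \<le> ?n" "?N \<subseteq> ?W i0" by blast
        have "decomposes E (k + 4 * k) ({z} \<union> ?W i0) (?C \<union> ?W i0) ((\<union>) (?W i0) ` \<B>)"
          by (rule decomposes_Un[OF \<B> path_window_finite path_window_card])
        moreover have "?W i0 \<subseteq> set P" by (auto simp: path_window_def path_ends_def)
        ultimately show ?thesis using \<B>0(2)[OF i0(1)] i0(2)
          by (intro exI[of _ "?W i0"] exI[of _ "?W i0"] exI[of _ "{z} \<union> ?W i0"] exI[of _ "(\<union>) (?W i0) ` \<B>"]) auto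
      qed
    qed
    then show ?thesis by blast
  qed
qed

section \<open>Packing disjoint spiders\<close>

text \<open>The number \<open>3 * k + 1\<close> counts the centre and three legs. Bounding
  \<open>X\<close> by it bounds the cost of putting \<open>X\<close> back into all bags.\<close>

primrec spiders :: "'a rel \<Rightarrow> nat \<Rightarrow> nat \<Rightarrow> 'a set \<Rightarrow> bool" where
  "spiders E k 0 U \<longleftrightarrow> True"
| "spiders E k (Suc m) U \<longleftrightarrow>
    (\<exists>X\<subseteq>U. finite X \<and> card X \<le> 3 * k + 1 \<and> spider E k X \<and> spiders E k m (U - X))"

text \<open>Spiders are deleted greedily: after one deletion the rest has no \<open>m\<close>
  further disjoint spiders, and the deleted vertices are added to every bag of its decomposition.
  For \<open>m = 0\<close> the hypothesis is contradictory.\<close>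

lemma no_spiders_decomposes:
  assumes "sym E" "0 < k"
  shows "finite U \<Longrightarrow> \<not> spiders E k m U \<Longrightarrow> \<exists>R \<B>. decomposes E (5 * k + m * (3 * k + 1)) R U \<B>"
proof (induction m arbitrary: U)
  case (Suc m)
  show ?case
  proof (cases "spider E k U")
    case True
    then obtain c p q r where X: "distinct (c # p @ q @ r)" "set (c # p @ q @ r) \<subseteq> U"
      "length p = k" "length q = k" "length r = k"
      "consecutive (c # p) \<subseteq> E" "consecutive (c # q) \<subseteq> E" "consecutive (c # r) \<subseteq> E"
      unfolding spider_def by blast
    define X where "X = set (c # p @ q @ r)"
    have "spider E k X" using X unfolding spider_def X_def by blast
    moreover have "card X \<le> 3 * k + 1"
      using X card_length[of "c # p @ q @ r"] by (simp add: X_def)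
    moreover have fin: "finite X" by (simp add: X_def)
    moreover have sub: "X \<subseteq> U" using X by (simp add: X_def)
    ultimately have "\<not> spiders E k m (U - X)" using Suc.prems(2) by auto
    then obtain R \<B> where "decomposes E (5 * k + m * (3 * k + 1)) R (U - X) \<B>"
      using Suc by blast
    then have "decomposes E (5 * k + m * (3 * k + 1) + (3 * k + 1)) (R \<union> X) (U - X \<union> X) ((\<union>) X ` \<B>)"
      by (rule decomposes_Un) fact+
    moreover have "U - X \<union> X = U" using sub by blast
    moreover have "5 * k + m * (3 * k + 1) + (3 * k + 1) = 5 * k + Suc m * (3 * k + 1)" by simp
    ultimately show ?thesis by metis
  next
    case False
    then obtain R \<B> where "decomposes E (5 * k) R U \<B>"
      using no_spider_decomposes[OF assms Suc.prems(1)] by blast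
    then show ?thesis by (meson decomposes_mono le_add1)
  qed
qed simp

section \<open>Disjoint unions of paths and subdivided claws\<close>

text \<open>Legs may be empty, so one predicate describes subdivided claws, paths and single
  vertices.\<close>

definition spider_graph :: "'a \<Rightarrow> 'a list \<Rightarrow> 'a list \<Rightarrow> 'a list \<Rightarrow> 'a pair_pre_digraph \<Rightarrow> bool" where
  "spider_graph c p q r G \<longleftrightarrow> distinct (c # p @ q @ r) \<and> pverts G = set (c # p @ q @ r) \<and>
     parcs G = (let A = consecutive (c # p) \<union> consecutive (c # q) \<union> consecutive (c # r) in A \<union> A\<inverse>)"

lemma map_exists:
  "distinct xs \<Longrightarrow> length xs = length ys \<Longrightarrow> \<exists>f. map f xs = ys"
proof (induction xs arbitrary: ys)
  case (Cons x xs)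
  then obtain y zs where ys: "ys = y # zs" by (cases ys) auto
  then obtain f where "map f xs = zs" using Cons by auto
  then show ?case using ys Cons.prems(1) by (intro exI[of _ "f(x := y)"]) auto
qed simp

lemma map_prod_converse: "map_prod f f ` A\<inverse> = (map_prod f f ` A)\<inverse>"
  by (auto simp: image_iff)

text \<open>The vertex lists are matched position by position: leg lengths determine a spider up to
  isomorphism.\<close>

lemma spider_graph_iso:
  assumes "spider_graph c p q r G" "spider_graph c' p' q' r' G'"
    and len: "length p = length p'" "length q = length q'" "length r = length r'"
  shows "\<exists>h. inj_on h (pverts G) \<and> pverts G' = h ` pverts G \<and> parcs G' = map_prod h h ` parcs G"
proof -
  let ?xs = "c # p @ q @ r" and ?ys = "c' # p' @ q' @ r'"
  obtain h where h: "map h ?xs = ?ys"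
    using map_exists[of ?xs ?ys] assms unfolding spider_graph_def by auto
  then have maps: "map h (c # p) = c' # p'" "map h (c # q) = c' # q'" "map h (c # r) = c' # r'"
    using len by auto
  have "inj_on h (pverts G)"
    using assms h distinct_map[of h ?xs] unfolding spider_graph_def by metis
  moreover have "pverts G' = h ` pverts G"
    using assms h set_map[of h ?xs] unfolding spider_graph_def by metis
  moreover have "parcs G' = map_prod h h ` parcs G"
    using assms(1,2) unfolding spider_graph_def Let_def
    by (simp only: maps[symmetric] consecutive_map image_Un map_prod_converse)
  ultimately show ?thesis by blast
qed

lemma spider_graph_map:
  assumes "spider_graph c p q r G" "inj_on h (pverts G)" "pverts G' = h ` pverts G"
    "parcs G' = map_prod h h ` parcs G"
  shows "spider_graph (h c) (map h p) (map h q) (map h r) G'"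
proof -
  have eq: "h c # map h p @ map h q @ map h r = map h (c # p @ q @ r)"
    "h c # map h p = map h (c # p)" "h c # map h q = map h (c # q)" "h c # map h r = map h (c # r)"
    by simp_all
  have "distinct (map h (c # p @ q @ r))"
    using assms unfolding spider_graph_def by (metis distinct_map)
  moreover have "pverts G' = set (map h (c # p @ q @ r))"
    using assms unfolding spider_graph_def by (metis set_map)
  ultimately show ?thesis
    using assms(1,4) unfolding spider_graph_def eq consecutive_map Let_def
    by (simp only: image_Un map_prod_converse simp_thms)
qed

lemma spider_graph_arcs: "spider_graph c p q r G \<Longrightarrow> parcs G \<subseteq> pverts G \<times> pverts G"
  using consecutive_subset[of "c # p"] consecutive_subset[of "c # q"] consecutive_subset[of "c # r"]
  unfolding spider_graph_def Let_def by auto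

text \<open>A leg consists of the new vertices on an edge and the leaf at its end, hence the
  \<open>Suc\<close>.\<close>

lemma edge_subdivision_claw:
  assumes "edge_subdivision s claw S"
  shows "\<exists>c p q r. spider_graph c p q r S \<and> length p = Suc (s {0, 1}) \<and>
    length q = Suc (s {0, 2}) \<and> length r = Suc (s {0, 3})"
proof -
  obtain P :: "nat \<Rightarrow> nat \<Rightarrow> nat list" where
    P: "\<And>u v. (u, v) \<in> parcs claw \<Longrightarrow> length (P u v) = s {u, v} \<and> P v u = rev (P u v) \<and>
        distinct (P u v) \<and> set (P u v) \<inter> pverts claw = {}"
    and disj: "\<And>u v x y. (u, v) \<in> parcs claw \<Longrightarrow> (x, y) \<in> parcs claw \<Longrightarrow> {u, v} \<noteq> {x, y} \<Longrightarrow>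
        set (P u v) \<inter> set (P x y) = {}"
    and verts: "pverts S = pverts claw \<union> (\<Union>(u, v)\<in>parcs claw. set (P u v))"
    and arcs: "parcs S = (\<Union>(u, v)\<in>parcs claw. consecutive (u # P u v @ [v]))"
    using assms unfolding edge_subdivision_def by (smt (verit) case_prodD)
  have claw: "parcs claw = {(0, 1), (0, 2), (0, 3), (1, 0), (2, 0), (3, 0)}"
    "pverts claw = {0, 1, 2, 3}" by (auto simp: claw_def)
  have rev: "P 1 0 = rev (P 0 1)" "P 2 0 = rev (P 0 2)" "P 3 0 = rev (P 0 3)"
    using P[of 0 1] P[of 0 2] P[of 0 3] by (simp_all add: claw)
  have len: "length (P 0 1) = s {0, 1}" "length (P 0 2) = s {0, 2}" "length (P 0 3) = s {0, 3}"
    using P[of 0 1] P[of 0 2] P[of 0 3] by (simp_all add: claw)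
  have fresh: "distinct (P 0 i)" "0 \<notin> set (P 0 i)" "1 \<notin> set (P 0 i)" "2 \<notin> set (P 0 i)" "3 \<notin> set (P 0 i)"
    if "i \<in> {1, 2, 3}" for i
    using P[of 0 i] that by (auto simp: claw)
  have dis: "set (P 0 1) \<inter> set (P 0 2) = {}" "set (P 0 1) \<inter> set (P 0 3) = {}" "set (P 0 2) \<inter> set (P 0 3) = {}"
    using disj[of 0 1 0 2] disj[of 0 1 0 3] disj[of 0 2 0 3] by (simp_all add: claw doubleton_eq_iff)
  have conv: "consecutive (i # rev xs @ [0]) = (consecutive (0 # xs @ [i]))\<inverse>" for i :: nat and xs
    using consecutive_rev[of "0 # xs @ [i]"] by simp
  have "parcs S = consecutive (0 # P 0 1 @ [1]) \<union> consecutive (0 # P 0 2 @ [2]) \<union> consecutive (0 # P 0 3 @ [3])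
    \<union> ((consecutive (0 # P 0 1 @ [1]))\<inverse> \<union> (consecutive (0 # P 0 2 @ [2]))\<inverse> \<union> (consecutive (0 # P 0 3 @ [3]))\<inverse>)"
    unfolding arcs claw by (simp only: UN_insert UN_empty prod.case rev conv) blast
  moreover have "pverts S = set (0 # (P 0 1 @ [1]) @ (P 0 2 @ [2]) @ (P 0 3 @ [3]))"
    unfolding verts claw by (simp only: UN_insert UN_empty prod.case rev set_rev) auto
  moreover have "distinct (0 # (P 0 1 @ [1]) @ (P 0 2 @ [2]) @ (P 0 3 @ [3]))"
    using fresh[of 1] fresh[of 2] fresh[of 3] dis by auto
  ultimately show ?thesis
    using len unfolding spider_graph_def Let_def
    by (intro exI[of _ 0] exI[of _ "P 0 1 @ [1]"] exI[of _ "P 0 2 @ [2]"] exI[of _ "P 0 3 @ [3]"])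
      (simp only: converse_Un length_append_singleton simp_thms)
qed

text \<open>A new vertex is coded by its edge and its position on it, shifted by \<open>N\<close>
  beyond all vertices of \<open>G\<close>. The order \<open>u < v\<close> selects the direction in
  which an edge is numbered; the opposite list is the reversal.\<close>

lemma edge_subdivision_exists:
  assumes G: "simple_graph G"
  shows "\<exists>G'. edge_subdivision s G G'"
proof -
  define N where "N = Suc (Max (pverts G))"
  define Q where "Q u v = map (\<lambda>i. N + prod_encode (prod_encode (u, v), i)) [0..<s {u, v}]" for u v
  define P where "P u v = (if u < v then Q u v else rev (Q v u))" for u v
  have Q: "x = N + prod_encode (prod_encode (u, v), i)" "i < s {u, v}"
    if "(x, i) \<in> set (zip (Q u v) [0..<s {u, v}])" for x u v i
    using that by (auto simp: Q_def set_zip)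
  have setQ: "set (Q u v) = (\<lambda>i. N + prod_encode (prod_encode (u, v), i)) ` {..<s {u, v}}" for u v
    by (auto simp: Q_def)
  have distQ: "distinct (Q u v)" for u v
    by (auto simp: Q_def distinct_map inj_on_def)
  have big: "x < N" if "x \<in> pverts G" for x
    using that simple_graph_finite[OF G] by (simp add: N_def less_Suc_eq_le)
  have neq: "u \<noteq> v" if "(u, v) \<in> parcs G" for u v using that simple_graph_irrefl[OF G] by auto
  let ?G = "\<lparr>pverts = pverts G \<union> (\<Union>(u, v)\<in>parcs G. set (P u v)),
    parcs = (\<Union>(u, v)\<in>parcs G. consecutive (u # P u v @ [v]))\<rparr>"
  have "length (P u v) = s {u, v} \<and> P v u = rev (P u v) \<and> distinct (P u v) \<and> set (P u v) \<inter> pverts G = {}"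
    if "(u, v) \<in> parcs G" for u v
  proof -
    have "set (Q a b) \<inter> pverts G = {}" for a b using big[of "N + _"] by (auto simp: setQ)
    moreover have "length (Q a b) = s {a, b}" for a b by (simp add: Q_def)
    ultimately show ?thesis using neq[OF that] distQ
      by (auto simp: P_def insert_commute)
  qed
  moreover have "set (P u v) \<inter> set (P x y) = {}" if "{u, v} \<noteq> {x, y}" for u v x y
    using that by (auto simp: P_def setQ split: if_splits)
  ultimately have "edge_subdivision s G ?G"
    unfolding edge_subdivision_def by (intro exI[of _ P]) auto
  then show ?thesis by blast
qed

lemma claw_simple: "simple_graph claw"
  by (rule simple_graphI) (auto simp: claw_def sym_def)

text \<open>From right to left, any subdivision of the claw with these leg lengths will do, because
  it is isomorphic to \<open>G\<close>.\<close>

lemma is_subdivided_claw_iff: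
  assumes "1 \<le> a" "1 \<le> b" "1 \<le> d"
  shows "is_subdivided_claw a b d G \<longleftrightarrow>
    (\<exists>c p q r. spider_graph c p q r G \<and> length p = a \<and> length q = b \<and> length r = d)" (is "?L \<longleftrightarrow> ?R")
proof -
  let ?s = "\<lambda>e. if e = {0, 1} then a - 1 else if e = {0, 2} then b - 1 else d - 1 :: nat"
  have s: "Suc (?s {0, 1 :: nat}) = a" "Suc (?s {0, 2 :: nat}) = b" "Suc (?s {0, 3 :: nat}) = d"
    using assms by (auto simp: doubleton_eq_iff)
  show ?thesis
  proof
    assume ?L
    then obtain S where S: "edge_subdivision ?s claw S" "digraph_iso (with_proj S) (with_proj G)"
      unfolding is_subdivided_claw_def by blast
    obtain c p q r where sp: "spider_graph c p q r S" "length p = a" "length q = b" "length r = d"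
      using edge_subdivision_claw[OF S(1)] s by metis
    obtain h where "inj_on h (pverts S)" "pverts G = h ` pverts S" "parcs G = map_prod h h ` parcs S"
      using digraph_iso_with_projD[OF S(2)] .
    from spider_graph_map[OF sp(1) this] show ?R using sp by (metis length_map)
  next
    assume ?R
    then obtain c p q r where G: "spider_graph c p q r G" "length p = a" "length q = b" "length r = d" by blast
    obtain S where S: "edge_subdivision ?s claw S" using edge_subdivision_exists[OF claw_simple] by blast
    obtain c' p' q' r' where sp: "spider_graph c' p' q' r' S" "length p' = a" "length q' = b" "length r' = d"
      using edge_subdivision_claw[OF S] s by metis
    obtain h where h: "inj_on h (pverts S)" "pverts G = h ` pverts S" "parcs G = map_prod h h ` parcs S"
      using spider_graph_iso[OF sp(1) G(1)] sp(2-) G(2-) by auto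
    have "wf_digraph (with_proj S)"
      using spider_graph_arcs[OF sp(1)] unfolding wf_digraph_def by fastforce
    then have "digraph_iso (with_proj S) (with_proj G)" using h by (rule digraph_iso_with_projI)
    then show ?L using S unfolding is_subdivided_claw_def by blast
  qed
qed

definition \<S>_component :: "ngraph \<Rightarrow> bool" where
  "\<S>_component C \<longleftrightarrow> is_path_graph C \<or>
     (\<exists>p q r. 1 \<le> p \<and> 1 \<le> q \<and> 1 \<le> r \<and> is_subdivided_claw p q r C)"

lemma mem_\<S>_iff:
  "G \<in> \<S> \<longleftrightarrow> simple_graph G \<and> (\<exists>\<C>. finite \<C> \<and> (\<forall>C\<in>\<C>. \<S>_component C) \<and>
     pairwise (\<lambda>C D. disjnt (pverts C) (pverts D)) \<C> \<and>
     pverts G = (\<Union>C\<in>\<C>. pverts C) \<and> parcs G = (\<Union>C\<in>\<C>. parcs C))"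
  by (simp add: \<S>_def \<S>_component_def)

lemma \<S>_component_cases:
  assumes "\<S>_component C"
  obtains (path) xs where "xs \<noteq> []" "distinct xs" "pverts C = set xs" "parcs C = consecutive xs \<union> (consecutive xs)\<inverse>"
  | (claw) c p q r where "spider_graph c p q r C"
  using assms is_subdivided_claw_iff unfolding \<S>_component_def is_path_graph_def by metis

lemma \<S>_component_arcs:
  assumes "\<S>_component C"
  shows "parcs C \<subseteq> pverts C \<times> pverts C"
  using assms
proof (cases rule: \<S>_component_cases)
  case (path xs)
  then show ?thesis using consecutive_subset[of xs] by auto
next
  case (claw c p q r)
  then show ?thesis by (rule spider_graph_arcs)
qed

section \<open>Embedding members of \<S> into disjoint spiders\<close>

text \<open>A path on at most \<open>k\<close> vertices fits into the centre followed by one leg.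
  The legs of a subdivided claw of this order are shorter than \<open>k\<close> and become initial
  parts of the three legs.\<close>

lemma \<S>_component_embeds:
  assumes E: "sym E" and "spider E k X" "\<S>_component C" "card (pverts C) \<le> k"
  shows "\<exists>f. inj_on f (pverts C) \<and> f ` pverts C \<subseteq> X \<and> map_prod f f ` parcs C \<subseteq> E"
proof -
  obtain c p q r where X: "distinct (c # p @ q @ r)" "set (c # p @ q @ r) \<subseteq> X"
    "length p = k" "length q = k" "length r = k"
    "consecutive (c # p) \<subseteq> E" "consecutive (c # q) \<subseteq> E" "consecutive (c # r) \<subseteq> E"
    using assms(2) unfolding spider_def by blast
  have conv: "map_prod f f ` A\<inverse> \<subseteq> E" if "map_prod f f ` A \<subseteq> E" for f :: "nat \<Rightarrow> 'a" and A
    using that E by (auto dest: symD)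
  show ?thesis
    using assms(3)
  proof (cases rule: \<S>_component_cases)
    case (path xs)
    let ?ys = "take (length xs) (c # p)"
    have "length xs \<le> k" using assms(4) path distinct_card by metis
    then obtain f where f: "map f xs = ?ys" using map_exists[of xs ?ys] X(3) path(2) by auto
    have "distinct ?ys" using X(1) by (auto simp: distinct_take)
    then have "inj_on f (pverts C)" using f path(3) distinct_map by metis
    moreover have "f ` pverts C \<subseteq> X"
      using f path(3) set_map[of f xs] set_take_subset[of "length xs" "c # p"] X(2) by auto
    moreover have "map_prod f f ` consecutive xs \<subseteq> E"
      unfolding consecutive_map[symmetric] f by (rule order_trans[OF consecutive_take X(6)])
    then have "map_prod f f ` parcs C \<subseteq> E" using conv path(4) by (auto simp: image_Un)
    ultimately show ?thesis by blast
  next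
    case (claw c' p' q' r')
    let ?xs = "c' # p' @ q' @ r'"
    let ?p = "take (length p') p" and ?q = "take (length q') q" and ?r = "take (length r') r"
    have dist: "distinct ?xs" and verts: "pverts C = set ?xs" using claw by (simp_all add: spider_graph_def)
    then have "length ?xs \<le> k" using assms(4) distinct_card by metis
    then have len: "length p' \<le> k" "length q' \<le> k" "length r' \<le> k" by auto
    let ?ys = "c # ?p @ ?q @ ?r"
    obtain f where f: "map f ?xs = ?ys"
      using map_exists[OF dist, of ?ys] len X(3-5) by auto
    then have maps: "map f (c' # p') = take (Suc (length p')) (c # p)"
      "map f (c' # q') = take (Suc (length q')) (c # q)"
      "map f (c' # r') = take (Suc (length r')) (c # r)"
      using len X(3-5) by (auto simp: append_eq_append_conv)
    have "distinct ?ys" using X(1)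
      using set_take_subset[of "length p'" p] set_take_subset[of "length q'" q] set_take_subset[of "length r'" r]
      by auto
    then have "inj_on f (pverts C)" using f verts distinct_map by metis
    moreover have "f ` pverts C = set ?ys" using f verts set_map by metis
    then have "f ` pverts C \<subseteq> X"
      using X(2) set_take_subset[of "length p'" p] set_take_subset[of "length q'" q] set_take_subset[of "length r'" r]
      by auto
    moreover have "map_prod f f ` consecutive (c' # p') \<subseteq> E" "map_prod f f ` consecutive (c' # q') \<subseteq> E"
      "map_prod f f ` consecutive (c' # r') \<subseteq> E"
      unfolding consecutive_map[symmetric] maps
      by (rule order_trans[OF consecutive_take X(6)] order_trans[OF consecutive_take X(7)]
        order_trans[OF consecutive_take X(8)])+
    then have "map_prod f f ` parcs C \<subseteq> E"
      using claw conv unfolding spider_graph_def Let_def by (simp add: image_Un)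
    ultimately show ?thesis by blast
  qed
qed

text \<open>Each component gets a spider of its own; disjointness of the spiders makes the combined
  map injective.\<close>

lemma \<S>_components_embed:
  assumes E: "sym E"
  shows "finite \<C> \<Longrightarrow> spiders E k m U \<Longrightarrow> card \<C> \<le> m \<Longrightarrow>
    (\<And>C. C \<in> \<C> \<Longrightarrow> \<S>_component C \<and> card (pverts C) \<le> k) \<Longrightarrow>
    pairwise (\<lambda>C D. disjnt (pverts C) (pverts D)) \<C> \<Longrightarrow>
    \<exists>f. inj_on f (\<Union>C\<in>\<C>. pverts C) \<and> f ` (\<Union>C\<in>\<C>. pverts C) \<subseteq> U \<and>
      map_prod f f ` (\<Union>C\<in>\<C>. parcs C) \<subseteq> E"
proof (induction \<C> arbitrary: m U rule: finite_induct)
  case (insert C \<C>)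
  obtain m' where m: "m = Suc m'" using insert by (cases m) auto
  then obtain X where X: "X \<subseteq> U" "spider E k X" "spiders E k m' (U - X)" using insert.prems(1) by auto
  obtain g where g: "inj_on g (pverts C)" "g ` pverts C \<subseteq> X" "map_prod g g ` parcs C \<subseteq> E"
    using \<S>_component_embeds[OF E X(2), of C] insert.prems(3) by blast
  let ?V = "\<Union>C\<in>\<C>. pverts C"
  have "\<exists>f. inj_on f ?V \<and> f ` ?V \<subseteq> U - X \<and> map_prod f f ` (\<Union>C\<in>\<C>. parcs C) \<subseteq> E"
    using insert.prems(2-) insert.hyps m by (intro insert.IH[OF X(3)]) (auto simp: pairwise_insert)
  then obtain f where f: "inj_on f ?V" "f ` ?V \<subseteq> U - X" "map_prod f f ` (\<Union>C\<in>\<C>. parcs C) \<subseteq> E"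
    by blast
  have disj: "pverts C \<inter> ?V = {}"
    using insert.prems(4) insert.hyps(2) by (auto simp: pairwise_insert disjnt_def)
  define h where "h x = (if x \<in> pverts C then g x else f x)" for x
  have hg: "h x = g x" if "x \<in> pverts C" for x using that by (simp add: h_def)
  have hf: "h x = f x" if "x \<in> ?V" for x using that disj by (auto simp: h_def)
  have inj: "inj_on h (pverts C)" "inj_on h ?V"
    using inj_on_cong[of "pverts C" h g, OF hg] g(1) inj_on_cong[of ?V h f, OF hf] f(1) by blast+
  have hX: "h x \<in> X" if "x \<in> pverts C" for x using that hg g(2) by auto
  have hU: "h x \<in> U - X" if "x \<in> ?V" for x using that hf f(2) by (metis image_subset_iff)
  have img: "h ` pverts C \<subseteq> X" "h ` ?V \<subseteq> U - X" by (rule image_subsetI, erule hX hU)+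
  then have "h ` (pverts C - ?V) \<inter> h ` (?V - pverts C) = {}" 
    by (meson Diff_disjoint Diff_subset disjoint_iff image_mono order_trans subsetD DiffD2)
  then have "inj_on h (pverts C \<union> ?V)" using inj by (simp only: inj_on_Un simp_thms)
  moreover have "h ` (pverts C \<union> ?V) \<subseteq> U" unfolding image_Un using img X(1) by blast
  moreover have arcs: "map_prod h h (x, y) \<in> E" if xy: "(x, y) \<in> parcs C \<union> (\<Union>C\<in>\<C>. parcs C)" for x y
  proof (cases "(x, y) \<in> parcs C")
    case True
    then have "x \<in> pverts C" "y \<in> pverts C" using insert.prems(3)[of C] \<S>_component_arcs by blast+
    then show ?thesis using g(3) True hg by force
  next
    case False
    then obtain D where D: "D \<in> \<C>" "(x, y) \<in> parcs D" using xy by blast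
    then have "x \<in> pverts D" "y \<in> pverts D" using insert.prems(3)[of D] \<S>_component_arcs by blast+
    then have "x \<in> ?V" "y \<in> ?V" using D by blast+
    moreover have "map_prod f f (x, y) \<in> E" using f(3) D by blast
    ultimately show ?thesis using hf by simp
  qed
  then have "map_prod h h ` (parcs C \<union> (\<Union>C\<in>\<C>. parcs C)) \<subseteq> E" by (intro image_subsetI) force
  ultimately show ?case unfolding UN_insert by blast
qed auto

lemma \<S>_imp_bounded_treewidth:
  assumes "H \<in> \<H>" "H \<in> \<S>"
  shows "bounded_treewidth (subgraph_free \<H>)"
proof -
  obtain \<C> where H: "simple_graph H" and \<C>: "finite \<C>" "\<And>C. C \<in> \<C> \<Longrightarrow> \<S>_component C"
    "pairwise (\<lambda>C D. disjnt (pverts C) (pverts D)) \<C>"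
    "pverts H = (\<Union>C\<in>\<C>. pverts C)" "parcs H = (\<Union>C\<in>\<C>. parcs C)"
    using assms(2) unfolding mem_\<S>_iff by metis
  define k where "k = Suc (card (pverts H))"
  define m where "m = card \<C>"
  have card: "card (pverts C) \<le> k" if "C \<in> \<C>" for C
  proof -
    have "card (pverts C) \<le> card (pverts H)"
      using that \<C>(4) simple_graph_finite[OF H] by (intro card_mono) auto
    then show ?thesis by (simp add: k_def)
  qed
  have "treewidth G \<le> 5 * k + m * (3 * k + 1)" if "G \<in> subgraph_free \<H>" for G
  proof -
    have G: "simple_graph G" "\<not> contains_subgraph G H"
      using that assms(1) by (auto simp: subgraph_free_def)
    have sym: "sym (parcs G)" by (rule simple_graph_sym[OF G(1)])
    have "\<not> spiders (parcs G) k m (pverts G)"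
    proof
      assume "spiders (parcs G) k m (pverts G)"
      then obtain f where "inj_on f (pverts H)" "f ` pverts H \<subseteq> pverts G"
        "map_prod f f ` parcs H \<subseteq> parcs G"
        using \<S>_components_embed[OF sym \<C>(1), of k m "pverts G"] \<C> card unfolding m_def by auto
      then show False using contains_subgraphI[OF G(1) H] G(2) by blast
    qed
    then obtain R \<B> where "decomposes (parcs G) (5 * k + m * (3 * k + 1)) R (pverts G) \<B>"
      using no_spiders_decomposes[OF sym, of k "pverts G" m] simple_graph_finite[OF G(1)]
      by (auto simp: k_def)
    then show ?thesis by (rule decomposes_imp_treewidth[OF G(1)])
  qed
  then show ?thesis unfolding bounded_treewidth_def by blast
qed

section \<open>Ranked graphs\<close>

text \<open>The rank plays the role of the distance to a chosen root in each component.\<close>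

locale ranked_graph =
  fixes G :: ngraph and \<rho> :: "nat \<Rightarrow> nat"
  assumes simple: "simple_graph G"
    and rank_neq: "(x, y) \<in> parcs G \<Longrightarrow> \<rho> x \<noteq> \<rho> y"
    and lower_unique: "(x, y) \<in> parcs G \<Longrightarrow> (x, z) \<in> parcs G \<Longrightarrow> \<rho> y < \<rho> x \<Longrightarrow> \<rho> z < \<rho> x \<Longrightarrow> y = z"
    and upper_unique: "(x, y) \<in> parcs G \<Longrightarrow> (x, z) \<in> parcs G \<Longrightarrow> \<rho> x < \<rho> y \<Longrightarrow> \<rho> x < \<rho> z \<Longrightarrow>
      0 < \<rho> x \<Longrightarrow> y = z"
    and root_degree: "\<rho> x = 0 \<Longrightarrow> card {y. (x, y) \<in> parcs G} \<le> 3"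
begin

definition up :: "nat rel" where
  "up = {(x, y) \<in> parcs G. \<rho> x < \<rho> y}"

lemma sym: "(x, y) \<in> parcs G \<Longrightarrow> (y, x) \<in> parcs G"
  using simple_graph_sym[OF simple] by (auto dest: symD)

lemma arcs_up: "parcs G = up \<union> up\<inverse>"
proof
  show "parcs G \<subseteq> up \<union> up\<inverse>"
  proof (rule subrelI)
    fix x y assume "(x, y) \<in> parcs G"
    then show "(x, y) \<in> up \<union> up\<inverse>" using rank_neq[of x y] sym[of x y] by (auto simp: up_def)
  qed
  show "up \<union> up\<inverse> \<subseteq> parcs G" using sym by (auto simp: up_def)
qed

lemma up_single: "single_valued (up\<inverse>)"
  unfolding single_valued_def
proof (intro allI impI)
  fix x y z assume "(x, y) \<in> up\<inverse>" "(x, z) \<in> up\<inverse>"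
  then show "y = z" using lower_unique[of x y z] sym[of y x] sym[of z x] by (auto simp: up_def)
qed

lemma up_finite: "finite up"
  by (rule finite_subset[OF _ simple_graph_finite_arcs[OF simple]]) (auto simp: up_def)

lemma up_rtrancl_rank: "(x, y) \<in> up\<^sup>* \<Longrightarrow> \<rho> x \<le> \<rho> y"
  by (induction rule: rtrancl_induct) (auto simp: up_def)

text \<open>Lower neighbours are unique, so descending from \<open>z\<close> leaves no choice and
  one descent is part of the other.\<close>

lemma up_comparable: "(x, z) \<in> up\<^sup>* \<Longrightarrow> (y, z) \<in> up\<^sup>* \<Longrightarrow> (x, y) \<in> up\<^sup>* \<or> (y, x) \<in> up\<^sup>*"
  using single_valued_confluent[OF up_single, of z x y] by (auto simp: rtrancl_converse)

text \<open>A vertex of positive rank has at most one upper neighbour, so nothing branches above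
  \<open>x\<close>. The path ends because ranks increase along it and are bounded; the induction is
  on the distance to the largest rank.\<close>

lemma up_chain_exists:
  assumes "0 < \<rho> x"
  shows "\<exists>xs. xs \<noteq> [] \<and> hd xs = x \<and> distinct xs \<and> consecutive xs \<subseteq> up \<and> up \<inter> set xs \<times> UNIV \<subseteq> consecutive xs \<and>
    set xs = up\<^sup>* `` {x}"
  using assms
proof (induction x rule: measure_induct_rule[where f = "\<lambda>x. Max (\<rho> ` Range up) - \<rho> x"])
  case (less x)
  show ?case
  proof (cases "\<exists>y. (x, y) \<in> up")
    case False
    then have "up\<^sup>* `` {x} = {x}" by (auto elim: converse_rtranclE)
    then show ?thesis using False by (intro exI[of _ "[x]"]) auto
  next
    case True
    then obtain y where y: "(x, y) \<in> up" by blast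
    have lt: "\<rho> x < \<rho> y" using y by (simp add: up_def)
    have uniq: "z = y" if "(x, z) \<in> up" for z
      using upper_unique[of x z y] y that less.prems by (simp add: up_def)
    have "\<rho> y \<le> Max (\<rho> ` Range up)"
      using y up_finite by (intro Max_ge) (auto simp: finite_Range)
    then have "Max (\<rho> ` Range up) - \<rho> y < Max (\<rho> ` Range up) - \<rho> x" using lt by linarith
    then obtain ys where ys: "ys \<noteq> []" "hd ys = y" "distinct ys" "consecutive ys \<subseteq> up"
      "up \<inter> set ys \<times> UNIV \<subseteq> consecutive ys" "set ys = up\<^sup>* `` {y}"
      using less.IH[of y] lt by auto
    have "x \<notin> set ys" using ys(6) up_rtrancl_rank[of y x] lt by auto
    moreover have "(y, z) \<in> up\<^sup>*" if "(x, z) \<in> up\<^sup>*" "z \<noteq> x" for z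
      using that(1) by (cases rule: converse_rtranclE) (use uniq that(2) in auto)
    then have "up\<^sup>* `` {x} = insert x (up\<^sup>* `` {y})"
      using y by (auto intro: converse_rtrancl_into_rtrancl)
    moreover have "up \<inter> set (x # ys) \<times> UNIV \<subseteq> consecutive (x # ys)"
      using ys(1,2,5) uniq by (auto simp: consecutive_Cons)
    ultimately show ?thesis
      using ys y by (intro exI[of _ "x # ys"]) (auto simp: consecutive_Cons)
  qed
qed

text \<open>A root need not have rank 0: a component without a vertex of rank 0 is rooted at its
  vertex of least rank.\<close>

definition roots :: "nat set" where
  "roots = {x \<in> pverts G. \<forall>y. (y, x) \<notin> up}"

definition tree_at :: "nat \<Rightarrow> ngraph" where
  "tree_at x = \<lparr>pverts = up\<^sup>* `` {x}, parcs = parcs G \<inter> (up\<^sup>* `` {x}) \<times> (up\<^sup>* `` {x})\<rparr>"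

lemma root_above:
  assumes "x \<in> pverts G"
  shows "\<exists>r\<in>roots. (r, x) \<in> up\<^sup>*"
  using assms
proof (induction x rule: measure_induct_rule[where f = \<rho>])
  case (less x)
  show ?case
  proof (cases "x \<in> roots")
    case False
    then obtain y where y: "(y, x) \<in> up" using less.prems by (auto simp: roots_def)
    then have "y \<in> pverts G" "\<rho> y < \<rho> x"
      using simple_graph_arcs[OF simple] by (auto simp: up_def)
    then show ?thesis using less.IH y by (meson rtrancl.rtrancl_into_rtrancl)
  qed auto
qed

lemma tree_at_subset: "x \<in> pverts G \<Longrightarrow> up\<^sup>* `` {x} \<subseteq> pverts G"
proof
  fix y assume "x \<in> pverts G" "y \<in> up\<^sup>* `` {x}"
  then have "(x, y) \<in> up\<^sup>*" by simp
  then show "y \<in> pverts G" using \<open>x \<in> pverts G\<close> simple_graph_arcs[OF simple]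
    by induction (auto simp: up_def)
qed

lemma root_disjoint:
  assumes "r \<in> roots" "s \<in> roots" "(r, x) \<in> up\<^sup>*" "(s, x) \<in> up\<^sup>*"
  shows "r = s"
proof -
  have "a = b" if "(a, b) \<in> up\<^sup>*" "b \<in> roots" for a b
    using that(1) by (cases rule: rtranclE) (use that(2) in \<open>auto simp: roots_def\<close>)
  then show ?thesis using up_comparable[OF assms(3,4)] assms(1,2) by metis
qed

lemma root_children:
  assumes "r \<in> roots"
  shows "card {y. (r, y) \<in> up} \<le> 3"
proof (cases "\<rho> r = 0")
  case True
  have "finite {y. (r, y) \<in> parcs G}"
    using simple_graph_finite[OF simple] simple_graph_arcs[OF simple] by (auto elim!: rev_finite_subset)
  then have "card {y. (r, y) \<in> up} \<le> card {y. (r, y) \<in> parcs G}"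
    by (rule card_mono) (auto simp: up_def)
  then show ?thesis using root_degree[OF True] by simp
next
  case False
  have "card {y. (r, y) \<in> up} \<le> 1"
  proof (cases "\<exists>y. (r, y) \<in> up")
    case True
    then obtain y where "(r, y) \<in> up" by blast
    then have "{y. (r, y) \<in> up} \<subseteq> {y}" using upper_unique[of r] False by (auto simp: up_def)
    then show ?thesis using card_mono[of "{y}"] by simp
  qed simp
  then show ?thesis by simp
qed

text \<open>A root has at most three upper neighbours, and the paths rising from them are the
  legs.\<close>

lemma tree_at_spider:
  assumes r: "r \<in> roots"
  shows "\<exists>p q s. spider_graph r p q s (tree_at r)"
proof -
  let ?K = "{y. (r, y) \<in> up}"
  have fin: "finite ?K" using finite_Range[OF up_finite] by (rule rev_finite_subset) auto
  obtain ks where ks: "set ks = ?K" "distinct ks" using finite_distinct_list[OF fin] by blast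
  then have len: "length ks \<le> 3" using root_children[OF r] distinct_card by metis
  define chain where "chain y xs \<longleftrightarrow> xs \<noteq> [] \<and> hd xs = y \<and> distinct xs \<and> consecutive xs \<subseteq> up \<and>
    up \<inter> set xs \<times> UNIV \<subseteq> consecutive xs \<and> set xs = up\<^sup>* `` {y}" for y xs
  have "\<forall>y\<in>?K. \<exists>xs. chain y xs"
    unfolding chain_def by (intro ballI up_chain_exists) (auto simp: up_def)
  from bchoice[OF this] obtain f where chain: "\<And>y. y \<in> ?K \<Longrightarrow> chain y (f y)" by blast
  have f: "\<And>y. y \<in> ?K \<Longrightarrow> f y \<noteq> []" "\<And>y. y \<in> ?K \<Longrightarrow> hd (f y) = y"
    "\<And>y. y \<in> ?K \<Longrightarrow> distinct (f y)" "\<And>y. y \<in> ?K \<Longrightarrow> consecutive (f y) \<subseteq> up"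
    "\<And>y. y \<in> ?K \<Longrightarrow> up \<inter> set (f y) \<times> UNIV \<subseteq> consecutive (f y)"
    "\<And>y. y \<in> ?K \<Longrightarrow> set (f y) = up\<^sup>* `` {y}"
    using chain unfolding chain_def by blast+
  \<comment> \<open>Missing children yield empty legs, so that there are always three.\<close>
  define l where "l i = (if i < length ks then f (ks ! i) else [])" for i
  have K: "ks ! i \<in> ?K" if "i < length ks" for i using ks(1) that nth_mem by blast
  have setl: "set (l i) = (if i < length ks then up\<^sup>* `` {ks ! i} else {})" for i
    using f(6)[OF K, of i] by (auto simp: l_def)
  have distl: "distinct (l i)" for i using f(3)[OF K] by (simp add: l_def)
  have rl: "r \<notin> set (l i)" for i
  proof
    assume "r \<in> set (l i)"
    then have "(ks ! i, r) \<in> up\<^sup>*" "i < length ks" by (auto simp: setl split: if_splits)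
    then show False using up_rtrancl_rank[of "ks ! i" r] K[of i] by (auto simp: up_def)
  qed
  \<comment> \<open>If two legs met, one child would be reachable upwards from the other. The last
    step of that ascent comes from \<open>r\<close>, the only lower neighbour, so \<open>r\<close>
    would be reachable upwards from its own child, against the ranks.\<close>
  have sep: False if "(a, x) \<in> up\<^sup>*" "(b, x) \<in> up\<^sup>*" "(r, a) \<in> up" "(r, b) \<in> up" "a \<noteq> b" for a b x
  proof -
    have aux: False if ab: "(a, b) \<in> up\<^sup>*" "(r, a) \<in> up" "(r, b) \<in> up" "a \<noteq> b" for a b
    proof -
      obtain d where d: "(a, d) \<in> up\<^sup>*" "(d, b) \<in> up" using ab(1,4) by (metis rtranclE)
      then have "d = r" using up_single ab(3) by (auto simp: single_valued_def)
      then show False using up_rtrancl_rank[OF d(1)] ab(2) by (auto simp: up_def)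
    qed
    show False using up_comparable[OF that(1,2)] aux[of a b] aux[of b a] that by auto
  qed
  have disjl: "set (l i) \<inter> set (l j) = {}" if "i \<noteq> j" for i j
  proof (rule ccontr)
    assume "set (l i) \<inter> set (l j) \<noteq> {}"
    then obtain x where "(ks ! i, x) \<in> up\<^sup>*" "(ks ! j, x) \<in> up\<^sup>*" "i < length ks" "j < length ks"
      by (auto simp: setl split: if_splits)
    then show False using sep[of "ks ! i" x "ks ! j"] K that ks(2) by (auto simp: nth_eq_iff_index_eq)
  qed
  have consl: "consecutive (r # l i) = (if i < length ks then insert (r, ks ! i) (consecutive (f (ks ! i))) else {})" for i
    using f(1,2)[OF K, of i] by (auto simp: l_def consecutive_Cons)
  have "\<exists>i<3. y = ks ! i \<and> i < length ks" if "(r, y) \<in> up" for y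
    using that ks(1) len by (metis in_set_conv_nth mem_Collect_eq order_less_le_trans)
  note child = this
  have verts: "up\<^sup>* `` {r} = insert r (set (l 0) \<union> set (l 1) \<union> set (l 2))"
  proof
    show "up\<^sup>* `` {r} \<subseteq> insert r (set (l 0) \<union> set (l 1) \<union> set (l 2))"
    proof
      fix x assume "x \<in> up\<^sup>* `` {r}"
      then have "(r, x) \<in> up\<^sup>*" by simp
      then show "x \<in> insert r (set (l 0) \<union> set (l 1) \<union> set (l 2))"
      proof (cases rule: converse_rtranclE)
        case (step y)
        then obtain i where "i < 3" "i < length ks" "x \<in> set (l i)" using child[of y] by (auto simp: setl)
        moreover have "i = 0 \<or> i = 1 \<or> i = 2" using \<open>i < 3\<close> by auto
        ultimately show ?thesis by auto
      qed simp
    qed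
    show "insert r (set (l 0) \<union> set (l 1) \<union> set (l 2)) \<subseteq> up\<^sup>* `` {r}"
      using K by (auto simp: setl intro: converse_rtrancl_into_rtrancl split: if_splits)
  qed
  let ?A = "consecutive (r # l 0) \<union> consecutive (r # l 1) \<union> consecutive (r # l 2)"
  have "up \<inter> (up\<^sup>* `` {r}) \<times> (up\<^sup>* `` {r}) = ?A"
  proof
    have "consecutive (r # l i) \<subseteq> up \<inter> (up\<^sup>* `` {r}) \<times> (up\<^sup>* `` {r})" if "i \<in> {0, 1, 2}" for i
    proof
      fix z assume z: "z \<in> consecutive (r # l i)"
      then have "z \<in> set (r # l i) \<times> set (r # l i)" using consecutive_subset by blast
      then have "z \<in> (up\<^sup>* `` {r}) \<times> (up\<^sup>* `` {r})" using verts that by auto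
      moreover have "z \<in> up" using z f(4)[OF K] K by (auto simp: consl split: if_splits)
      ultimately show "z \<in> up \<inter> (up\<^sup>* `` {r}) \<times> (up\<^sup>* `` {r})" by blast
    qed
    then show "?A \<subseteq> up \<inter> (up\<^sup>* `` {r}) \<times> (up\<^sup>* `` {r})" by blast
    show "up \<inter> (up\<^sup>* `` {r}) \<times> (up\<^sup>* `` {r}) \<subseteq> ?A"
    proof
      fix z assume z: "z \<in> up \<inter> (up\<^sup>* `` {r}) \<times> (up\<^sup>* `` {r})"
      obtain x y where xy: "z = (x, y)" by (cases z)
      have "\<exists>i<3. z \<in> consecutive (r # l i)"
      proof (cases "x = r")
        case True
        then show ?thesis using child[of y] z xy consl by auto
      next
        case False
        then have "x \<in> set (l 0) \<or> x \<in> set (l 1) \<or> x \<in> set (l 2)"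
          using z xy by (simp add: verts)
        moreover have "(0::nat) < 3" "(1::nat) < 3" "(2::nat) < 3" by simp_all
        ultimately obtain i where i: "i < 3" "x \<in> set (l i)" by metis
        then have "i < length ks" "x \<in> set (f (ks ! i))" using f(6)[OF K] by (auto simp: setl split: if_splits)
        then have "z \<in> consecutive (f (ks ! i))" using f(5)[OF K, of i] z xy by blast
        then show ?thesis using i \<open>i < length ks\<close> consl by auto
      qed
      then obtain i where "i < 3" "z \<in> consecutive (r # l i)" by blast
      moreover have "i = 0 \<or> i = 1 \<or> i = 2" using \<open>i < 3\<close> by auto
      ultimately show "z \<in> ?A" by auto
    qed
  qed
  then have "parcs (tree_at r) = ?A \<union> ?A\<inverse>"
    unfolding tree_at_def arcs_up by (simp only: pair_pre_digraph.simps) blast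
  moreover have "distinct (r # l 0 @ l 1 @ l 2)"
    using rl distl disjl[of 0 1] disjl[of 0 2] disjl[of 1 2] by auto
  moreover have "pverts (tree_at r) = set (r # l 0 @ l 1 @ l 2)" using verts by (simp add: tree_at_def Un_assoc)
  ultimately show ?thesis unfolding spider_graph_def Let_def by blast
qed

end

text \<open>If a leg is empty, the other two form the path \<open>rev p @ c # q\<close> through the
  centre.\<close>

lemma spider_graph_component:
  assumes "spider_graph c p q r G"
  shows "\<S>_component G"
proof -
  have path: "is_path_graph G" if "spider_graph c p q [] G" for p q
  proof -
    have "consecutive (rev p @ c # q) = (consecutive (c # p))\<inverse> \<union> consecutive (c # q)"
      using consecutive_rev[of "c # p"] consecutive_append[of "rev p @ [c]" q]
      by (auto simp: consecutive_Cons)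
    then have "parcs G = consecutive (rev p @ c # q) \<union> (consecutive (rev p @ c # q))\<inverse>"
      using that unfolding spider_graph_def Let_def by auto
    then show ?thesis
      using that unfolding is_path_graph_def spider_graph_def by (intro exI[of _ "rev p @ c # q"]) auto
  qed
  show ?thesis
  proof (cases "p = [] \<or> q = [] \<or> r = []")
    case True
    moreover have "spider_graph c q r [] G" if "p = []"
      using assms that by (simp add: spider_graph_def Un_ac)
    moreover have "spider_graph c p r [] G" if "q = []"
      using assms that by (simp add: spider_graph_def Un_ac)
    ultimately have "\<exists>p q. spider_graph c p q [] G" using assms by blast
    then show ?thesis using path unfolding \<S>_component_def by blast
  next
    case False
    then have "1 \<le> length p" "1 \<le> length q" "1 \<le> length r" by (auto simp: Suc_le_eq)
    then show ?thesis using assms is_subdivided_claw_iff unfolding \<S>_component_def by blast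
  qed
qed

text \<open>The trees above the roots are the components: every arc points upwards in one of its
  directions, and both of its ends then lie above the same root.\<close>

lemma (in ranked_graph) mem_\<S>: "G \<in> \<S>"
proof -
  have sub: "roots \<subseteq> pverts G" by (auto simp: roots_def)
  have "pairwise (\<lambda>C D. disjnt (pverts C) (pverts D)) (tree_at ` roots)"
    using root_disjoint by (fastforce simp: pairwise_def disjnt_def tree_at_def)
  moreover have "pverts G = (\<Union>C\<in>tree_at ` roots. pverts C)"
    using root_above tree_at_subset sub by (fastforce simp: tree_at_def)
  moreover have "parcs G = (\<Union>C\<in>tree_at ` roots. parcs C)"
  proof
    show "parcs G \<subseteq> (\<Union>C\<in>tree_at ` roots. parcs C)"
    proof
      fix z assume z: "z \<in> parcs G"
      obtain x y where xy: "z = (x, y)" by (cases z)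
      have "\<exists>a b. (a, b) \<in> up \<and> {a, b} = {x, y}" using z xy arcs_up by (auto simp: insert_commute)
      then obtain a b where ab: "(a, b) \<in> up" "{a, b} = {x, y}" by blast
      have "a \<in> pverts G" using ab(1) simple_graph_arcs[OF simple] by (auto simp: up_def)
      then obtain r where r: "r \<in> roots" "(r, a) \<in> up\<^sup>*" using root_above by blast
      then have "(r, b) \<in> up\<^sup>*" using ab(1) by (meson rtrancl.rtrancl_into_rtrancl)
      then have "z \<in> parcs (tree_at r)" using r ab(2) z xy by (auto simp: tree_at_def doubleton_eq_iff)
      then show "z \<in> (\<Union>C\<in>tree_at ` roots. parcs C)" using r by blast
    qed
  qed (auto simp: tree_at_def)
  moreover have "\<forall>C\<in>tree_at ` roots. \<S>_component C"
    using tree_at_spider spider_graph_component by blast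
  moreover have "finite (tree_at ` roots)"
    using sub simple_graph_finite[OF simple] by (meson finite_imageI finite_subset)
  ultimately show ?thesis using simple unfolding mem_\<S>_iff by blast
qed

section \<open>Small subgraphs of subdivisions\<close>

locale subdivision =
  fixes G G' :: ngraph and k :: nat and P :: "nat \<Rightarrow> nat \<Rightarrow> nat list"
  assumes simple: "simple_graph G"
    and len: "(u, v) \<in> parcs G \<Longrightarrow> length (P u v) = k"
    and rev: "(u, v) \<in> parcs G \<Longrightarrow> P v u = rev (P u v)"
    and dist: "(u, v) \<in> parcs G \<Longrightarrow> distinct (P u v)"
    and fresh: "(u, v) \<in> parcs G \<Longrightarrow> set (P u v) \<inter> pverts G = {}"
    and disj: "(u, v) \<in> parcs G \<Longrightarrow> (x, y) \<in> parcs G \<Longrightarrow> {u, v} \<noteq> {x, y} \<Longrightarrow>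
      set (P u v) \<inter> set (P x y) = {}"
    and verts: "pverts G' = pverts G \<union> (\<Union>(u, v)\<in>parcs G. set (P u v))"
    and arcs: "parcs G' = (\<Union>(u, v)\<in>parcs G. consecutive (u # P u v @ [v]))"

lemma edge_subdivision_imp_subdivision:
  assumes "simple_graph G" "edge_subdivision (\<lambda>_. k) G G'"
  shows "\<exists>P. subdivision G G' k P"
proof -
  obtain P where P: "\<forall>(u, v)\<in>parcs G. length (P u v) = k \<and> P v u = List.rev (P u v) \<and>
      distinct (P u v) \<and> set (P u v) \<inter> pverts G = {}"
    and disj: "\<forall>(u, v)\<in>parcs G. \<forall>(x, y)\<in>parcs G. {u, v} \<noteq> {x, y} \<longrightarrow> set (P u v) \<inter> set (P x y) = {}"
    and eqs: "pverts G' = pverts G \<union> (\<Union>(u, v)\<in>parcs G. set (P u v))"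
    "parcs G' = (\<Union>(u, v)\<in>parcs G. consecutive (u # P u v @ [v]))"
    using assms(2) unfolding edge_subdivision_def by (elim exE conjE) (rule that)
  have "subdivision G G' k P"
  proof
    fix u v assume uv: "(u, v) \<in> parcs G"
    show "length (P u v) = k" "P v u = List.rev (P u v)" "distinct (P u v)" "set (P u v) \<inter> pverts G = {}"
      using bspec[OF P uv] by simp_all
    fix x y assume xy: "(x, y) \<in> parcs G" "{u, v} \<noteq> {x, y}"
    have "\<forall>(x, y)\<in>parcs G. {u, v} \<noteq> {x, y} \<longrightarrow> set (P u v) \<inter> set (P x y) = {}"
      using bspec[OF disj uv] by simp
    from bspec[OF this xy(1)] show "set (P u v) \<inter> set (P x y) = {}" using xy(2) by simp
  qed (fact assms(1) eqs)+
  then show ?thesis by blast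
qed

context subdivision
begin

abbreviation line :: "nat \<Rightarrow> nat \<Rightarrow> nat list" where
  "line u v \<equiv> u # P u v @ [v]"

lemma arc_sym: "(u, v) \<in> parcs G \<Longrightarrow> (v, u) \<in> parcs G"
  using simple_graph_sym[OF simple] by (auto dest: symD)

lemma arc_verts: "(u, v) \<in> parcs G \<Longrightarrow> u \<in> pverts G \<and> v \<in> pverts G \<and> u \<noteq> v"
  using simple_graph_arcs[OF simple] simple_graph_irrefl[OF simple] by blast

lemma line_rev: "(u, v) \<in> parcs G \<Longrightarrow> line v u = List.rev (line u v)"
  by (simp add: rev)

lemma line_distinct: "(u, v) \<in> parcs G \<Longrightarrow> distinct (line u v)"
  using dist[of u v] fresh[of u v] arc_verts[of u v] by auto

lemma line_subset: "(u, v) \<in> parcs G \<Longrightarrow> set (line u v) \<subseteq> pverts G'"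
  using arc_verts[of u v] by (auto simp: verts)

lemma simple_subdivision: "simple_graph G'"
proof (rule simple_graphI)
  show "finite (pverts G')" using simple_graph_finite[OF simple] simple_graph_finite_arcs[OF simple] by (auto simp: verts)
  show "parcs G' \<subseteq> pverts G' \<times> pverts G'"
  proof
    fix z assume "z \<in> parcs G'"
    then obtain u v where "(u, v) \<in> parcs G" "z \<in> consecutive (line u v)" unfolding arcs by blast
    then show "z \<in> pverts G' \<times> pverts G'" using consecutive_subset[of "line u v"] line_subset[of u v] by blast
  qed
  show "sym (parcs G')"
  proof (rule symI)
    fix x y assume "(x, y) \<in> parcs G'"
    then obtain u v where uv: "(u, v) \<in> parcs G" "(x, y) \<in> consecutive (line u v)" unfolding arcs by blast
    then have "(y, x) \<in> consecutive (line v u)" unfolding line_rev[OF uv(1)] consecutive_rev by simp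
    then show "(y, x) \<in> parcs G'" using arc_sym[OF uv(1)] unfolding arcs by blast
  qed
  show "(x, x) \<notin> parcs G'" for x
  proof
    assume "(x, x) \<in> parcs G'"
    then obtain u v where uv: "(u, v) \<in> parcs G" "(x, x) \<in> consecutive (line u v)" unfolding arcs by blast
    then obtain i where "Suc i < length (line u v)" "line u v ! i = line u v ! Suc i"
      unfolding consecutive_conv_nth by auto
    then show False using nth_eq_iff_index_eq[OF line_distinct[OF uv(1)], of i "Suc i"] by simp
  qed
  show "pverts G' \<noteq> {}" using simple_graph_nonempty[OF simple] by (simp add: verts)
qed

text \<open>Requiring \<open>u < v\<close> fixes one of the two directions of an edge, so that new
  vertices have unique coordinates.\<close>

lemma interior_unique:
  assumes "(u, v) \<in> parcs G" "u < v" "j < k" "(x, y) \<in> parcs G" "x < y" "i < k" "P u v ! j = P x y ! i"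
  shows "u = x \<and> v = y \<and> j = i"
proof -
  have "P u v ! j \<in> set (P u v)" using assms(3) len[OF assms(1)] by simp
  moreover have "P x y ! i \<in> set (P x y)" using assms(6) len[OF assms(4)] by simp
  ultimately have "{u, v} = {x, y}" using disj[OF assms(1,4)] assms(7) by (metis disjoint_iff)
  then have "u = x" "v = y" using assms(2,5) by (auto simp: doubleton_eq_iff)
  then show ?thesis using assms dist[of x y] len[of x y] by (auto simp: nth_eq_iff_index_eq)
qed

lemma line_nth: "(u, v) \<in> parcs G \<Longrightarrow> 0 < i \<Longrightarrow> i \<le> k \<Longrightarrow> line u v ! i = P u v ! (i - 1)"
  using len[of u v] by (auto simp: nth_Cons nth_append split: nat.splits)

lemma line_last: "(u, v) \<in> parcs G \<Longrightarrow> line u v ! Suc k = v"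
  using len[of u v] by (simp add: nth_append)

lemma line_interior: "(u, v) \<in> parcs G \<Longrightarrow> 0 < i \<Longrightarrow> i \<le> k \<Longrightarrow> line u v ! i \<notin> pverts G"
  using line_nth[of u v i] fresh[of u v] len[of u v] by (auto simp: disjoint_iff)

lemma arc_cases:
  assumes "(x, y) \<in> parcs G'"
  obtains u v i where "(u, v) \<in> parcs G" "u < v" "i \<le> k"
    "(x, y) = (line u v ! i, line u v ! Suc i) \<or> (y, x) = (line u v ! i, line u v ! Suc i)"
proof -
  obtain a b where ab: "(a, b) \<in> parcs G" "(x, y) \<in> consecutive (line a b)" using assms unfolding arcs by blast
  show ?thesis
  proof (cases "a < b")
    case True
    obtain i where "Suc i < length (line a b)" "(x, y) = (line a b ! i, line a b ! Suc i)"
      using ab(2) unfolding consecutive_conv_nth by blast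
    then show ?thesis using that[OF ab(1) True, of i] len[OF ab(1)] by simp
  next
    case False
    then have ba: "(b, a) \<in> parcs G" "b < a" using ab(1) arc_sym arc_verts[of a b] by auto
    have "(y, x) \<in> consecutive (line b a)" using ab(2) unfolding line_rev[OF ab(1)] consecutive_rev by simp
    then obtain i where "Suc i < length (line b a)" "(y, x) = (line b a ! i, line b a ! Suc i)"
      unfolding consecutive_conv_nth by blast
    then show ?thesis using that[OF ba, of i] len[OF ba(1)] by simp
  qed
qed

text \<open>By uniqueness of coordinates, no arc from another subdivided edge touches a new
  vertex.\<close>

lemma interior_neighbours:
  assumes uv: "(u, v) \<in> parcs G" "u < v" "0 < j" "j \<le> k" and arc: "(line u v ! j, y) \<in> parcs G'"
  shows "y = line u v ! (j - 1) \<or> y = line u v ! Suc j"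
proof -
  obtain a b i where ab: "(a, b) \<in> parcs G" "a < b" "i \<le> k"
    "(line u v ! j, y) = (line a b ! i, line a b ! Suc i) \<or> (y, line u v ! j) = (line a b ! i, line a b ! Suc i)"
    using arc by (rule arc_cases)
  have *: "u = a \<and> v = b \<and> j = l" if "line u v ! j = line a b ! l" "l \<le> Suc k" for l
  proof -
    have notin: "line a b ! l \<notin> pverts G" using line_interior[OF uv(1,3,4)] that by simp
    then have "l \<noteq> 0" using arc_verts[OF ab(1)] by (cases l) auto
    moreover have "l \<noteq> Suc k" using notin arc_verts[OF ab(1)] line_last[OF ab(1)] by metis
    ultimately have l: "0 < l" "l \<le> k" using that by auto
    then have "P u v ! (j - 1) = P a b ! (l - 1)"
      using that line_nth[OF uv(1,3,4)] line_nth[OF ab(1) l] by simp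
    then have "u = a \<and> v = b \<and> j - 1 = l - 1"
      using interior_unique[OF uv(1,2) _ ab(1,2), of "j - 1" "l - 1"] l uv by simp
    then show ?thesis using l(1) uv(3) by arith
  qed
  show ?thesis using ab(3,4) *[of i] *[of "Suc i"] by auto
qed

text \<open>An arc leaving an original vertex must start a \<open>line\<close>, so there are at most
  as many such arcs as arcs of \<open>G\<close> leaving that vertex.\<close>

lemma branch_neighbours:
  assumes "u \<in> pverts G"
  shows "{y. (u, y) \<in> parcs G'} \<subseteq> (\<lambda>e. line (fst e) (snd e) ! 1) ` {e \<in> parcs G. fst e = u}"
proof
  fix y assume "y \<in> {y. (u, y) \<in> parcs G'}"
  then obtain a b where ab: "(a, b) \<in> parcs G" "(u, y) \<in> consecutive (line a b)" unfolding arcs by blast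
  then obtain i where i: "Suc i < length (line a b)" "u = line a b ! i" "y = line a b ! Suc i"
    unfolding consecutive_conv_nth by blast
  have "i = 0" using line_interior[OF ab(1), of i] assms i len[OF ab(1)] by (cases "i = 0") auto
  then show "y \<in> (\<lambda>e. line (fst e) (snd e) ! 1) ` {e \<in> parcs G. fst e = u}" using i ab(1) by force
qed

text \<open>
  The rank of a vertex is its distance, along its subdivided edge, to the endpoint on its side
  of the missing vertex.
\<close>

lemma small_subgraph_mem_\<S>:
  assumes cubic: "\<And>v. v \<in> pverts G \<Longrightarrow> out_degree (with_proj G) v \<le> 3"
    and H: "simple_graph H" "card (pverts H) < k"
    and f: "inj_on f (pverts H)" "f ` pverts H \<subseteq> pverts G'" "map_prod f f ` parcs H \<subseteq> parcs G'"
  shows "H \<in> \<S>"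
proof -
  let ?V = "f ` pverts H"
  have "\<exists>m. m < k \<and> P u v ! m \<notin> ?V" if uv: "(u, v) \<in> parcs G" for u v
  proof (rule ccontr)
    assume "\<not> ?thesis"
    then have "set (P u v) \<subseteq> ?V" using len[OF uv] by (auto simp: in_set_conv_nth)
    then have "card (set (P u v)) \<le> card ?V" using simple_graph_finite[OF H(1)] by (intro card_mono) auto
    then show False using H(2) len[OF uv] distinct_card[OF dist[OF uv]] card_image[OF f(1)] by simp
  qed
  then obtain m where m: "\<And>u v. (u, v) \<in> parcs G \<Longrightarrow> m u v < k \<and> P u v ! m u v \<notin> ?V" by metis
  \<comment> \<open>The index \<open>i\<close> counts along \<open>line u v\<close>, so the missing
    vertex \<open>P u v ! m u v\<close> has index \<open>Suc (m u v)\<close>. The two endpoints, at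
    \<open>0\<close> and \<open>Suc k\<close>, both get rank 0.\<close>
  define rank where "rank u v i = (if i \<le> m u v then i else Suc k - i)" for u v i
  \<comment> \<open>The \<open>THE\<close> is well defined because coordinates with
    \<open>u < v\<close> are unique.\<close>
  define \<rho>' where "\<rho>' x = (if x \<in> pverts G then 0 else
    THE r. \<exists>u v j. (u, v) \<in> parcs G \<and> u < v \<and> j < k \<and> x = P u v ! j \<and> r = rank u v (Suc j))" for x
  have rank: "\<rho>' (line u v ! i) = rank u v i" if uv: "(u, v) \<in> parcs G" "u < v" "i \<le> Suc k" for u v i
  proof -
    consider "i = 0" | "i = Suc k" | "0 < i" "i \<le> k" using uv by linarith
    then show ?thesis
    proof cases
      case 1
      then show ?thesis using arc_verts[OF uv(1)] by (simp add: \<rho>'_def rank_def)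
    next
      case 2
      then show ?thesis using arc_verts[OF uv(1)] line_last[OF uv(1)] m[OF uv(1)]
        by (simp add: \<rho>'_def rank_def)
    next
      case 3
      have "\<rho>' (line u v ! i) = (THE r. \<exists>a b j. (a, b) \<in> parcs G \<and> a < b \<and> j < k \<and>
          P u v ! (i - 1) = P a b ! j \<and> r = rank a b (Suc j))"
        using line_interior[OF uv(1) 3] line_nth[OF uv(1) 3] by (simp only: \<rho>'_def if_False)
      also have "\<dots> = rank u v i"
      proof (rule the_equality)
        show "\<exists>a b j. (a, b) \<in> parcs G \<and> a < b \<and> j < k \<and> P u v ! (i - 1) = P a b ! j \<and>
          rank u v i = rank a b (Suc j)"
          using uv 3 by (intro exI[of _ u] exI[of _ v] exI[of _ "i - 1"]) auto
      next
        fix r assume "\<exists>a b j. (a, b) \<in> parcs G \<and> a < b \<and> j < k \<and> P u v ! (i - 1) = P a b ! j \<and>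
          r = rank a b (Suc j)"
        then obtain a b j where ab: "(a, b) \<in> parcs G" "a < b" "j < k" "P u v ! (i - 1) = P a b ! j"
          "r = rank a b (Suc j)" by blast
        then have "u = a \<and> v = b \<and> i - 1 = j" using interior_unique[OF uv(1,2) _ ab(1,2,3,4)] 3 by simp
        then show "r = rank u v i" using ab(5) 3 by auto
      qed
      finally show ?thesis .
    qed
  qed
  have gap: "i \<noteq> Suc (m u v)" if "(u, v) \<in> parcs G" "line u v ! i \<in> ?V" for u v i
    using that m[OF that(1)] line_nth[OF that(1), of i] by auto
  have interior: "\<exists>u v i. (u, v) \<in> parcs G \<and> u < v \<and> 0 < i \<and> i \<le> k \<and> x = line u v ! i"
    if x: "x \<in> pverts G'" "x \<notin> pverts G" for x
  proof -
    obtain a b where ab: "(a, b) \<in> parcs G" "x \<in> set (P a b)" using x by (auto simp: verts)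
    have "\<exists>u v. (u, v) \<in> parcs G \<and> u < v \<and> x \<in> set (P u v)"
    proof (cases "a < b")
      case False
      then show ?thesis using ab arc_sym[OF ab(1)] arc_verts[OF ab(1)] rev[OF ab(1)]
        by (intro exI[of _ b] exI[of _ a]) auto
    qed (use ab in blast)
    then obtain u v j where uv: "(u, v) \<in> parcs G" "u < v" "j < k" "x = P u v ! j"
      using len by (metis in_set_conv_nth)
    then show ?thesis using line_nth[OF uv(1), of "Suc j"]
      by (intro exI[of _ u] exI[of _ v] exI[of _ "Suc j"]) auto
  qed
  have rank_pos: "x \<notin> pverts G" if "0 < \<rho>' x" for x using that by (auto simp: \<rho>'_def)
  have fV: "f x \<in> ?V" "f y \<in> ?V" "(f x, f y) \<in> parcs G'" "x \<in> pverts H" "y \<in> pverts H"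
    if "(x, y) \<in> parcs H" for x y
    using that f(3) simple_graph_arcs[OF H(1)] by auto
  \<comment> \<open>Here \<open>l\<close> is the neighbour towards the endpoint from which the rank
    counts, and \<open>h\<close> the one towards the missing vertex.\<close>
  have sides: "\<exists>l h. (\<forall>y\<in>?V. (x, y) \<in> parcs G' \<longrightarrow> (\<rho>' y < \<rho>' x \<longrightarrow> y = l) \<and> (\<rho>' x < \<rho>' y \<longrightarrow> y = h))"
    if x: "x \<in> ?V" "0 < \<rho>' x" for x
  proof -
    obtain u v i where uv: "(u, v) \<in> parcs G" "u < v" "0 < i" "i \<le> k" "x = line u v ! i"
      using interior rank_pos[OF x(2)] x(1) f(2) by blast
    have \<rho>x: "\<rho>' x = rank u v i" unfolding uv(5) by (rule rank[OF uv(1,2)]) (use uv in simp)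
    have i: "i \<noteq> Suc (m u v)" using gap[OF uv(1)] x(1) uv(5) by blast
    let ?a = "line u v ! (i - 1)" and ?b = "line u v ! Suc i"
    have \<rho>: "\<rho>' ?a = rank u v (i - 1)" "\<rho>' ?b = rank u v (Suc i)"
      by (rule rank[OF uv(1,2)], use uv in simp)+
    have nb: "y = ?a \<or> y = ?b" if "(x, y) \<in> parcs G'" for y
      using interior_neighbours[OF uv(1-4)] that uv(5) by simp
    have sort: ?thesis if sort: "\<And>y. y \<in> ?V \<Longrightarrow> (x, y) \<in> parcs G' \<Longrightarrow>
        y = a \<and> \<rho>' y < \<rho>' x \<or> y = b \<and> \<rho>' x < \<rho>' y" for a b
    proof (intro exI ballI impI conjI)
      fix y assume y: "y \<in> ?V" "(x, y) \<in> parcs G'"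
      show "y = a" if "\<rho>' y < \<rho>' x" using sort[OF y] that by auto
      show "y = b" if "\<rho>' x < \<rho>' y" using sort[OF y] that by auto
    qed
    show ?thesis
    proof (cases "i \<le> m u v")
      case True
      have "\<rho>' ?a < \<rho>' x" using True uv(3) unfolding \<rho>x \<rho> rank_def by auto
      \<comment> \<open>For \<open>i = m u v\<close> the next vertex is the missing one, whose rank
        counts from the other endpoint; hence the condition.\<close>
      moreover have "\<rho>' x < \<rho>' ?b" if "?b \<in> ?V"
        using True gap[OF uv(1) that] unfolding \<rho>x \<rho> rank_def by auto
      ultimately show ?thesis using nb by (intro sort[of ?a ?b]) metis
    next
      case False
      have "\<rho>' ?b < \<rho>' x" using False uv(4) unfolding \<rho>x \<rho> rank_def by auto
      moreover have "\<rho>' x < \<rho>' ?a" using False i uv(4) unfolding \<rho>x \<rho> rank_def by auto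
      ultimately show ?thesis using nb by (intro sort[of ?b ?a]) metis
    qed
  qed
  interpret H: ranked_graph H "\<rho>' \<circ> f"
  proof
    fix x y assume xy: "(x, y) \<in> parcs H"
    obtain u v i where uv: "(u, v) \<in> parcs G" "u < v" "i \<le> k"
      "(f x, f y) = (line u v ! i, line u v ! Suc i) \<or> (f y, f x) = (line u v ! i, line u v ! Suc i)"
      using fV(3)[OF xy] by (rule arc_cases)
    then have "line u v ! i \<in> ?V" "line u v ! Suc i \<in> ?V" using fV(1,2)[OF xy] by auto
    \<comment> \<open>Equal ranks can occur only between index \<open>m u v\<close> and the missing
      vertex, which is not in the image.\<close>
    then have "i \<noteq> Suc (m u v)" "i \<noteq> m u v" using gap[OF uv(1)] by blast+
    then have "rank u v i \<noteq> rank u v (Suc i)" using uv(3) by (auto simp: rank_def)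
    then show "(\<rho>' \<circ> f) x \<noteq> (\<rho>' \<circ> f) y" using uv rank[OF uv(1,2), of i] rank[OF uv(1,2), of "Suc i"] by auto
  next
    fix x y z assume xy: "(x, y) \<in> parcs H" "(x, z) \<in> parcs H"
      and lt: "(\<rho>' \<circ> f) y < (\<rho>' \<circ> f) x" "(\<rho>' \<circ> f) z < (\<rho>' \<circ> f) x"
    have "0 < \<rho>' (f x)" using lt by simp
    then obtain l h where lh: "\<And>y. y \<in> ?V \<Longrightarrow> (f x, y) \<in> parcs G' \<Longrightarrow>
        (\<rho>' y < \<rho>' (f x) \<longrightarrow> y = l) \<and> (\<rho>' (f x) < \<rho>' y \<longrightarrow> y = h)"
      using sides[OF fV(1)[OF xy(1)]] by metis
    have "f y = f z" using lh[OF fV(2,3)[OF xy(1)]] lh[OF fV(2,3)[OF xy(2)]] lt by simp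
    then show "y = z" using f(1) fV(5)[OF xy(1)] fV(5)[OF xy(2)] by (meson inj_onD)
  next
    fix x y z assume xy: "(x, y) \<in> parcs H" "(x, z) \<in> parcs H"
      and lt: "(\<rho>' \<circ> f) x < (\<rho>' \<circ> f) y" "(\<rho>' \<circ> f) x < (\<rho>' \<circ> f) z" "0 < (\<rho>' \<circ> f) x"
    have "0 < \<rho>' (f x)" using lt by simp
    then obtain l h where lh: "\<And>y. y \<in> ?V \<Longrightarrow> (f x, y) \<in> parcs G' \<Longrightarrow>
        (\<rho>' y < \<rho>' (f x) \<longrightarrow> y = l) \<and> (\<rho>' (f x) < \<rho>' y \<longrightarrow> y = h)"
      using sides[OF fV(1)[OF xy(1)]] by metis
    have "f y = f z" using lh[OF fV(2,3)[OF xy(1)]] lh[OF fV(2,3)[OF xy(2)]] lt by simp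
    then show "y = z" using f(1) fV(5)[OF xy(1)] fV(5)[OF xy(2)] by (meson inj_onD)
  next
    fix x assume r: "(\<rho>' \<circ> f) x = 0"
    show "card {y. (x, y) \<in> parcs H} \<le> 3"
    proof (cases "x \<in> pverts H")
      case False
      then have "{y. (x, y) \<in> parcs H} = {}" using fV(4) by blast
      then show ?thesis by simp
    next
      case True
      \<comment> \<open>New vertices have positive rank, whichever endpoint it counts from.\<close>
      have "f x \<in> pverts G"
      proof (rule ccontr)
        assume "f x \<notin> pverts G"
        then obtain u v i where uv: "(u, v) \<in> parcs G" "u < v" "0 < i" "i \<le> k" "f x = line u v ! i"
          using interior[of "f x"] True f(2) by blast
        then have "rank u v i = 0" using rank[OF uv(1,2), of i] r by simp
        then show False using uv by (auto simp: rank_def split: if_splits)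
      qed
      let ?E = "{e \<in> parcs G. fst e = f x}"
      have "?E = out_arcs (with_proj G) (f x)" by (auto simp: out_arcs_def)
      then have E: "card ?E \<le> 3" using cubic[OF \<open>f x \<in> pverts G\<close>] by (simp add: out_degree_def)
      have fin: "finite ?E" using simple_graph_finite_arcs[OF simple] by simp
      let ?N = "{y. (x, y) \<in> parcs H}"
      have "?N \<subseteq> pverts H" using fV(5) by blast
      then have "card ?N = card (f ` ?N)" using f(1) by (metis card_image inj_on_subset)
      also have "f ` ?N \<subseteq> (\<lambda>e. line (fst e) (snd e) ! 1) ` ?E"
        by (rule order_trans[OF _ branch_neighbours[OF \<open>f x \<in> pverts G\<close>]]) (use fV(3) in blast)
      then have "card (f ` ?N) \<le> card ((\<lambda>e. line (fst e) (snd e) ! 1) ` ?E)"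
        by (rule card_mono[OF finite_imageI[OF fin]])
      also have "\<dots> \<le> card ?E" using fin by (rule card_image_le)
      finally show ?thesis using E by simp
    qed
  qed (fact H(1))
  show ?thesis by (rule H.mem_\<S>)
qed

end

section \<open>Unbounded treewidth of subdivisions\<close>

lemma treeD:
  assumes "is_tree T"
  shows tree_simple: "simple_graph T"
    and tree_connected: "x \<in> pverts T \<Longrightarrow> y \<in> pverts T \<Longrightarrow> (x, y) \<in> (parcs T)\<^sup>*"
    and tree_acyclic: "distinct xs \<Longrightarrow> 3 \<le> length xs \<Longrightarrow> consecutive xs \<subseteq> parcs T \<Longrightarrow> (last xs, hd xs) \<notin> parcs T"
proof -
  show G: "simple_graph T" using assms by (simp add: is_tree_def)
  show "(x, y) \<in> (parcs T)\<^sup>*" if "x \<in> pverts T" "y \<in> pverts T"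
    using assms that connected_with_proj_iff[OF simple_graph_sym[OF G] simple_graph_arcs[OF G]]
    by (simp add: is_tree_def)
  show "(last xs, hd xs) \<notin> parcs T" if "distinct xs" "3 \<le> length xs" "consecutive xs \<subseteq> parcs T"
    using assms that long_cycle_iff[OF simple_graph_wf[OF G]] unfolding is_tree_def by blast
qed

text \<open>Following \<open>n\<close> forever would close a cycle unless some edge is traversed in both directions.\<close>

lemma tree_turning_point:
  assumes T: "is_tree T" and n: "\<And>t. t \<in> pverts T \<Longrightarrow> (t, n t) \<in> parcs T"
  shows "\<exists>t\<in>pverts T. n (n t) = t"
proof (rule ccontr)
  assume no: "\<not> (\<exists>t\<in>pverts T. n (n t) = t)"
  have G: "simple_graph T" by (rule tree_simple[OF T])
  obtain t0 where t0: "t0 \<in> pverts T" using simple_graph_nonempty[OF G] by blast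
  define a where "a i = (n ^^ i) t0" for i
  have aS: "a (Suc i) = n (a i)" for i by (simp add: a_def)
  have aV: "a i \<in> pverts T" for i
    by (induction i) (use t0 n simple_graph_arcs[OF G] in \<open>auto simp: aS, auto simp: a_def\<close>)
  have "\<not> inj a"
    using simple_graph_finite[OF G] aV finite_imageD[of a UNIV] finite_subset[of "range a" "pverts T"] by auto
  then obtain i j where "a i = a j" "i < j" unfolding inj_def by (metis linorder_neqE_nat)
  then have "0 < j - i" "a i = a (i + (j - i))" by simp_all
  then have ex: "\<exists>d. 0 < d \<and> (\<exists>i. a i = a (i + d))" by blast
  \<comment> \<open>The least return time over all starting points makes the vertices of one round
    distinct. The value 1 would give a loop and 2 a turning point, so a cycle of length at least 3
    remains.\<close>
  define d where "d = (LEAST d. 0 < d \<and> (\<exists>i. a i = a (i + d)))"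
  have "0 < d \<and> (\<exists>i. a i = a (i + d))" unfolding d_def by (rule LeastI_ex[OF ex])
  then obtain i where d: "0 < d" and i: "a i = a (i + d)" by blast
  have min: "d \<le> e" if "0 < e" "a p = a (p + e)" for p e
    unfolding d_def by (rule Least_le) (use that in blast)
  define xs where "xs = map a [i..<i + d]"
  have inj: "inj_on a {i..<i + d}"
  proof (rule linorder_inj_onI)
    fix p q assume pq: "p < q" "p \<in> {i..<i + d}" "q \<in> {i..<i + d}"
    show "a p \<noteq> a q" using min[of "q - p" p] pq by auto
  qed auto
  have arc: "(a p, a (Suc p)) \<in> parcs T" for p unfolding aS by (rule n[OF aV])
  have "d \<noteq> 1"
  proof
    assume "d = 1"
    then have "a (Suc i) = a i" using i by simp
    then show False using arc[of i] simple_graph_irrefl[OF G] by simp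
  qed
  moreover have "d \<noteq> 2"
  proof
    assume "d = 2"
    then have "a (Suc (Suc i)) = a i" using i by simp
    then show False using no aV[of i] unfolding aS by blast
  qed
  ultimately have "3 \<le> length xs" using d by (simp add: xs_def)
  have "distinct xs" using inj by (simp add: xs_def distinct_map)
  moreover note \<open>3 \<le> length xs\<close>
  moreover have "consecutive xs \<subseteq> parcs T"
    using arc by (auto simp: consecutive_conv_nth xs_def)
  moreover have "(last xs, hd xs) \<in> parcs T"
  proof -
    have "last xs = a (i + d - 1)" "hd xs = a i" using d by (simp_all add: xs_def last_map hd_map)
    moreover have "Suc (i + d - 1) = i + d" using d by simp
    ultimately show ?thesis using arc[of "i + d - 1"] i by metis
  qed
  ultimately show False using tree_acyclic[OF T] by blast
qed

text \<open>The two walks combine to a walk from \<open>t'\<close> to \<open>t\<close> that does not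
  use the edge between them. Shortened to a path, it closes a long cycle with this edge.\<close>

lemma tree_edge_separates:
  assumes T: "is_tree T" and e: "(t, t') \<in> parcs T"
    and "(t', s) \<in> (Restr (parcs T) (- {t}))\<^sup>*" "(t, s) \<in> (Restr (parcs T) (- {t'}))\<^sup>*"
  shows False
proof -
  let ?R = "parcs T - {(t, t'), (t', t)}"
  have G: "simple_graph T" by (rule tree_simple[OF T])
  have "sym ?R" using simple_graph_sym[OF G] by (auto simp: sym_def)
  have "(t', s) \<in> ?R\<^sup>*" using rtrancl_mono[of "Restr (parcs T) (- {t})" ?R] assms(3) by blast
  moreover have "(t, s) \<in> ?R\<^sup>*" using rtrancl_mono[of "Restr (parcs T) (- {t'})" ?R] assms(4) by blast
  then have "(s, t) \<in> ?R\<^sup>*" using sym_rtrancl[OF \<open>sym ?R\<close>] by (auto dest: symD)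
  ultimately have "(t', t) \<in> (Restr ?R UNIV)\<^sup>*" by auto
  then obtain xs where xs: "path_in ?R UNIV xs" "xs \<noteq> []" "hd xs = t'" "last xs = t"
    using rtrancl_imp_path_in[of t' t ?R UNIV] by blast
  have "t \<noteq> t'" using e simple_graph_irrefl[OF G] by blast
  obtain y ys where ys: "xs = t' # y # ys"
    using xs \<open>t \<noteq> t'\<close> by (cases xs; cases "tl xs") auto
  then have "ys \<noteq> []" using xs by (auto simp: path_in_def)
  then have "3 \<le> length xs" using ys by (cases ys) auto
  moreover have "distinct xs" "consecutive xs \<subseteq> parcs T" using xs(1) by (auto simp: path_in_def)
  ultimately show False using tree_acyclic[OF T, of xs] e xs by simp
qed

text \<open>The nodes whose bags meet \<open>S i\<close> form a subtree \<open>X i\<close>, and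
  these subtrees intersect pairwise, so this is the Helly property. If no node lay in all of them,
  every node could point along an edge towards a subtree avoiding it; two nodes pointing at each
  other would then separate two of the subtrees.\<close>

lemma tree_decomposition_hits:
  assumes G: "simple_graph G" and td: "tree_decomposition G T B"
    and S: "\<And>i. i \<in> I \<Longrightarrow> S i \<noteq> {} \<and> S i \<subseteq> pverts G"
    and conn: "\<And>i x y. i \<in> I \<Longrightarrow> x \<in> S i \<Longrightarrow> y \<in> S i \<Longrightarrow> (x, y) \<in> (Restr (parcs G) (S i))\<^sup>*"
    and meet: "\<And>i j. i \<in> I \<Longrightarrow> j \<in> I \<Longrightarrow> S i \<inter> S j \<noteq> {}"
  shows "\<exists>t\<in>pverts T. \<forall>i\<in>I. B t \<inter> S i \<noteq> {}"
proof (rule ccontr)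
  assume no: "\<not> ?thesis"
  have T: "is_tree T" and cover: "(\<Union>t\<in>pverts T. B t) = pverts G"
    and edge: "\<forall>(u, v)\<in>parcs G. \<exists>t\<in>pverts T. u \<in> B t \<and> v \<in> B t"
    and bag_conn: "\<forall>v\<in>pverts G. Digraph_Component.connected (induce_subgraph (with_proj T) {t \<in> pverts T. v \<in> B t})"
    using td by (simp_all add: tree_decomposition_def)
  have sym: "sym (parcs T)" by (rule simple_graph_sym[OF tree_simple[OF T]])
  define X where "X i = {t \<in> pverts T. B t \<inter> S i \<noteq> {}}" for i
  have vconn: "(s, t) \<in> (Restr (parcs T) (X i))\<^sup>*"
    if i: "i \<in> I" and v: "v \<in> S i" "v \<in> B s" "v \<in> B t" and st: "s \<in> pverts T" "t \<in> pverts T" for i v s t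
  proof -
    let ?Y = "{t \<in> pverts T. v \<in> B t}"
    have "v \<in> pverts G" using S[OF i] v by blast
    then have "(s, t) \<in> (Restr (parcs T) ?Y)\<^sup>*"
      using bag_conn connected_induce_iff[OF sym, of ?Y] v st by blast
    moreover have "Restr (parcs T) ?Y \<subseteq> Restr (parcs T) (X i)" using v(1) by (auto simp: X_def)
    ultimately show ?thesis using rtrancl_mono by blast
  qed
  have Xconn: "(s, t) \<in> (Restr (parcs T) (X i))\<^sup>*" if i: "i \<in> I" and st: "s \<in> X i" "t \<in> X i" for i s t
  proof -
    obtain x y where xy: "x \<in> S i" "x \<in> B s" "y \<in> S i" "y \<in> B t" using st by (auto simp: X_def)
    \<comment> \<open>Along a walk inside \<open>S i\<close>, consecutive vertices share a bag, and
      nodes whose bags share a vertex are joined inside \<open>X i\<close>.\<close>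
    have "\<forall>t\<in>pverts T. y \<in> B t \<longrightarrow> (s, t) \<in> (Restr (parcs T) (X i))\<^sup>*"
      using conn[OF i xy(1,3)]
    proof (induction rule: rtrancl_induct)
      case base
      then show ?case using vconn[OF i xy(1,2)] st by (auto simp: X_def)
    next
      case (step y z)
      show ?case
      proof (intro ballI impI)
        fix t assume t: "t \<in> pverts T" "z \<in> B t"
        have "(y, z) \<in> parcs G" using step by blast
        from bspec[OF edge this] obtain r where r: "r \<in> pverts T" "y \<in> B r" "z \<in> B r" by auto
        have "(s, r) \<in> (Restr (parcs T) (X i))\<^sup>*" using step.IH r by blast
        also have "(r, t) \<in> (Restr (parcs T) (X i))\<^sup>*"
          by (rule vconn[OF i, of z]) (use step r t in auto)
        finally show "(s, t) \<in> (Restr (parcs T) (X i))\<^sup>*" .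
      qed
    qed
    then show ?thesis using xy st by (auto simp: X_def)
  qed
  have Xmeet: "X i \<inter> X j \<noteq> {}" if ij: "i \<in> I" "j \<in> I" for i j
  proof -
    obtain v where v: "v \<in> S i" "v \<in> S j" using meet[OF ij] by blast
    then have "v \<in> pverts G" using S[OF ij(1)] by blast
    then obtain t where "t \<in> pverts T" "v \<in> B t" using cover by blast
    then show ?thesis using v by (auto simp: X_def)
  qed
  \<comment> \<open>The node \<open>t'\<close> is the first step from \<open>t\<close> towards
    \<open>X i\<close>. Since \<open>X i\<close> is connected and avoids \<open>t\<close>, all of it
    lies on the side of \<open>t'\<close>.\<close>
  have "\<exists>i t'. i \<in> I \<and> (t, t') \<in> parcs T \<and> (\<forall>s\<in>X i. (t', s) \<in> (Restr (parcs T) (- {t}))\<^sup>*)"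
    if t: "t \<in> pverts T" for t
  proof -
    obtain i where i: "i \<in> I" "t \<notin> X i" using no t by (auto simp: X_def)
    obtain s where s: "s \<in> X i" using Xmeet[OF i(1,1)] by blast
    then have "(t, s) \<in> (Restr (parcs T) UNIV)\<^sup>*" using tree_connected[OF T t, of s] by (simp add: X_def)
    then obtain xs where xs: "path_in (parcs T) UNIV xs" "xs \<noteq> []" "hd xs = t" "last xs = s"
      using rtrancl_imp_path_in[of t s "parcs T" UNIV] by blast
    have "s \<noteq> t" using s i by blast
    then obtain t' ys where ys: "xs = t # t' # ys"
      using xs by (cases xs; cases "tl xs") auto
    have path: "consecutive zs \<subseteq> R \<Longrightarrow> zs \<noteq> [] \<Longrightarrow> (hd zs, last zs) \<in> R\<^sup>*" for zs :: "nat list" and R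
      by (induction zs) (auto simp: consecutive_Cons intro: converse_rtrancl_into_rtrancl split: if_splits)
    have "consecutive (t' # ys) \<subseteq> Restr (parcs T) (- {t})"
      using xs(1) ys consecutive_subset[of "t' # ys"] by (auto simp: path_in_def)
    from path[OF this] have "(t', s) \<in> (Restr (parcs T) (- {t}))\<^sup>*" using xs ys by simp
    moreover have "(s, r) \<in> (Restr (parcs T) (- {t}))\<^sup>*" if "r \<in> X i" for r
    proof -
      have "Restr (parcs T) (X i) \<subseteq> Restr (parcs T) (- {t})" using i(2) by blast
      then show ?thesis using Xconn[OF i(1) s that] rtrancl_mono by blast
    qed
    ultimately have "\<forall>r\<in>X i. (t', r) \<in> (Restr (parcs T) (- {t}))\<^sup>*" by (meson rtrancl_trans)
    moreover have "(t, t') \<in> parcs T" using xs(1) ys by (auto simp: path_in_def)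
    ultimately show ?thesis using i(1) by blast
  qed
  then obtain i n where n: "\<And>t. t \<in> pverts T \<Longrightarrow> i t \<in> I \<and> (t, n t) \<in> parcs T \<and>
      (\<forall>s\<in>X (i t). (n t, s) \<in> (Restr (parcs T) (- {t}))\<^sup>*)" by metis
  obtain t where t: "t \<in> pverts T" "n (n t) = t" using tree_turning_point[OF T, of n] n by blast
  have t': "n t \<in> pverts T" using n[OF t(1)] simple_graph_arcs[OF tree_simple[OF T]] by blast
  obtain s where "s \<in> X (i t)" "s \<in> X (i (n t))" using Xmeet n[OF t(1)] n[OF t'] by blast
  then show False using tree_edge_separates[OF T, of t "n t" s] n[OF t(1)] n[OF t'] t(2) by auto
qed

section \<open>Subcubic graphs whose subdivisions have large treewidth\<close>

text \<open>
  The \<open>n\<close> rows are pairwise adjacent paths, so contracting them gives a complete graph on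
  \<open>n\<close> vertices.
\<close>

definition crossing_graph :: "nat \<Rightarrow> ngraph" where
  "crossing_graph n = \<lparr>pverts = prod_encode ` ({..<n} \<times> {..<n}),
    parcs = {(prod_encode (i, j), prod_encode (i', j')) |i j i' j'. i < n \<and> j < n \<and> i' < n \<and> j' < n \<and>
      (i = i' \<and> (j' = Suc j \<or> j = Suc j') \<or> i \<noteq> j \<and> i' = j \<and> j' = i)}\<rparr>"

lemma crossing_graph_arc:
  "(prod_encode (i, j), prod_encode (i', j')) \<in> parcs (crossing_graph n) \<longleftrightarrow>
    i < n \<and> j < n \<and> i' < n \<and> j' < n \<and> (i = i' \<and> (j' = Suc j \<or> j = Suc j') \<or> i \<noteq> j \<and> i' = j \<and> j' = i)"
  by (simp add: crossing_graph_def)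

lemma crossing_graph_subcubic:
  assumes "0 < n"
  shows "crossing_graph n \<in> subcubic_graphs"
proof -
  let ?G = "crossing_graph n"
  have simple: "simple_graph ?G"
  proof (rule simple_graphI)
    show "sym (parcs ?G)" by (auto simp: crossing_graph_def sym_def)
    show "(x, x) \<notin> parcs ?G" for x by (auto simp: crossing_graph_def)
  qed (use assms in \<open>auto simp: crossing_graph_def\<close>)
  have "out_degree (with_proj ?G) v \<le> 3" if V: "v \<in> pverts ?G" for v
  proof -
    obtain i j where v: "v = prod_encode (i, j)" using V by (auto simp: crossing_graph_def)
    \<comment> \<open>For \<open>j = 0\<close> the second entry is \<open>(v, v)\<close>, which is
      not an arc but does no harm in an upper bound.\<close>
    let ?N = "[(v, prod_encode (i, Suc j)), (v, prod_encode (i, j - 1)), (v, prod_encode (j, i))]"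
    have "out_arcs (with_proj ?G) v \<subseteq> set ?N"
      by (auto simp: out_arcs_def crossing_graph_def v)
    then have "card (out_arcs (with_proj ?G) v) \<le> card (set ?N)" by (intro card_mono) auto
    also have "\<dots> \<le> 3" using card_length[of ?N] by simp
    finally show ?thesis by (simp add: out_degree_def)
  qed
  then show ?thesis using simple by (simp add: subcubic_graphs_def)
qed

text \<open>Each row is enlarged by the new vertices on all edges at it. Two enlarged rows share the
  new vertices of the edge between them, which exist since \<open>k > 0\<close>. Counting the rows
  that a bag meets, at most two for each of its vertices, gives the factor 2.\<close>

lemma crossing_subdivision_treewidth:
  assumes n: "2 \<le> n" and k: "0 < k" and sub: "subdivision (crossing_graph n) G' k P"
  shows "n \<le> 2 * (treewidth G' + 1)"
proof -
  interpret subdivision "crossing_graph n" G' k P by (rule sub)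
  let ?G = "crossing_graph n"
  define row where "row x = fst (prod_decode x)" for x
  define S where "S i = (\<Union>(u, v)\<in>{(u, v) \<in> parcs ?G. row u = i}. set (u # P u v))" for i
  have SI: "x \<in> S (row u)" if "(u, v) \<in> parcs ?G" "x = u \<or> x \<in> set (P u v)" for x u v
    using that by (auto simp: S_def)
  have SE: "\<exists>u v. (u, v) \<in> parcs ?G \<and> row u = i \<and> (x = u \<or> x \<in> set (P u v))" if "x \<in> S i" for x i
    using that by (auto simp: S_def)
  have path: "x \<in> set zs \<Longrightarrow> consecutive zs \<subseteq> R \<Longrightarrow> (hd zs, x) \<in> R\<^sup>*" for x R and zs :: "nat list"
  proof (induction zs)
    case (Cons z zs)
    then show ?case
      by (cases "x = z") (auto simp: consecutive_Cons intro: converse_rtrancl_into_rtrancl split: if_splits)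
  qed simp
  have rowv: "prod_encode (i, j) \<in> S i" if "i < n" "j < n" for i j
  proof -
    \<comment> \<open>\<open>S i\<close> is built from arcs, so the vertex must have an outgoing
      one; a neighbour in its own row exists because \<open>n\<close> is at least 2.\<close>
    define j' where "j' = (if j = 0 then 1 else j - 1)"
    have "(prod_encode (i, j), prod_encode (i, j')) \<in> parcs ?G"
      using that n by (auto simp: crossing_graph_arc j'_def)
    from SI[OF this] show ?thesis by (simp add: row_def)
  qed
  have Ssub: "S i \<noteq> {} \<and> S i \<subseteq> pverts G'" if "i \<in> {..<n}" for i
  proof
    show "S i \<noteq> {}" using rowv[of i 0] that n by auto
    show "S i \<subseteq> pverts G'"
      using SE line_subset by (fastforce simp del: insert_subset)
  qed
  have symR: "sym ((Restr (parcs G') (S i))\<^sup>*)" for i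
    using simple_graph_sym[OF simple_subdivision] by (intro sym_rtrancl) (auto simp: sym_def)
  \<comment> \<open>With \<open>v\<close> included in \<open>zs\<close> this moves along the row;
    without it, it reaches the new vertices on any edge leaving the row.\<close>
  have to_row: "(prod_encode (i, j), x) \<in> (Restr (parcs G') (S i))\<^sup>*"
    if "(prod_encode (i, j), v) \<in> parcs ?G" "x \<in> set (prod_encode (i, j) # zs)"
      "prod_encode (i, j) # zs @ ws = line (prod_encode (i, j)) v" "set zs \<subseteq> S i" for i j v x zs ws
  proof -
    let ?u = "prod_encode (i, j)"
    have "consecutive (?u # zs) \<subseteq> consecutive (line ?u v)"
      unfolding that(3)[symmetric] using consecutive_append[of "?u # zs" ws] by auto
    also have "\<dots> \<subseteq> parcs G'" using that(1) unfolding arcs by blast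
    finally have "consecutive (?u # zs) \<subseteq> parcs G'" .
    moreover have "?u \<in> S i" using SI[OF that(1)] by (simp add: row_def)
    then have "consecutive (?u # zs) \<subseteq> S i \<times> S i"
      using consecutive_subset[of "?u # zs"] that(4) by auto
    ultimately show ?thesis using path[OF that(2), of "Restr (parcs G') (S i)"] by auto
  qed
  have row_conn: "j < n \<longrightarrow> (prod_encode (i, 0), prod_encode (i, j)) \<in> (Restr (parcs G') (S i))\<^sup>*" if "i < n" for i j
  proof (induction j)
    case (Suc j)
    show ?case
    proof
      assume j: "Suc j < n"
      let ?u = "prod_encode (i, j)" and ?v = "prod_encode (i, Suc j)"
      have a: "(?u, ?v) \<in> parcs ?G" using j that by (simp add: crossing_graph_arc)
      have "set (P ?u ?v @ [?v]) \<subseteq> S i"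
        using SI[OF a] rowv[OF that j] by (auto simp: row_def)
      then have "(?u, ?v) \<in> (Restr (parcs G') (S i))\<^sup>*"
        by (intro to_row[OF a, of _ "P ?u ?v @ [?v]" "[]"]) auto
      then show "(prod_encode (i, 0), ?v) \<in> (Restr (parcs G') (S i))\<^sup>*" using Suc j by (simp add: rtrancl_trans)
    qed
  qed simp
  have base: "(prod_encode (i, 0), x) \<in> (Restr (parcs G') (S i))\<^sup>*" if i: "i < n" and x: "x \<in> S i" for i x
  proof -
    obtain u v where uv: "(u, v) \<in> parcs ?G" "row u = i" "x = u \<or> x \<in> set (P u v)" using SE[OF x] by blast
    obtain j where u: "u = prod_encode (i, j)" using uv(2) by (metis prod.collapse prod_decode_inverse row_def)
    have "j < n" using arc_verts[OF uv(1)] by (auto simp: u crossing_graph_def)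
    then have "(prod_encode (i, 0), u) \<in> (Restr (parcs G') (S i))\<^sup>*" using row_conn[OF i] u by blast
    also have "(u, x) \<in> (Restr (parcs G') (S i))\<^sup>*"
      unfolding u by (rule to_row[of i j v x "P u v" "[v]"]) (use uv u SI[OF uv(1)] in auto)
    finally show ?thesis .
  qed
  have conn: "(x, y) \<in> (Restr (parcs G') (S i))\<^sup>*" if "i \<in> {..<n}" "x \<in> S i" "y \<in> S i" for i x y
    using base[of i x] base[of i y] that symR[of i] by (meson lessThan_iff rtrancl_trans symD)
  have meet: "S i \<inter> S j \<noteq> {}" if "i \<in> {..<n}" "j \<in> {..<n}" for i j
  proof (cases "i = j")
    case True
    then show ?thesis using Ssub that by auto
  next
    case False
    let ?u = "prod_encode (i, j)" and ?v = "prod_encode (j, i)"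
    have a: "(?u, ?v) \<in> parcs ?G" using that False by (simp add: crossing_graph_arc)
    have "P ?u ?v \<noteq> []" using len[OF a] k by auto
    then have "hd (P ?u ?v) \<in> set (P ?u ?v)" "hd (P ?u ?v) \<in> set (P ?v ?u)" using rev[OF a] by simp_all
    then show ?thesis using SI[OF a] SI[OF arc_sym[OF a]] by (auto simp: row_def)
  qed
  obtain T B where T: "tree_decomposition G' T B" "decomposition_width T B = treewidth G'"
    using treewidth_attained[OF simple_subdivision] by blast
  obtain t where t: "t \<in> pverts T" "\<And>i. i < n \<Longrightarrow> B t \<inter> S i \<noteq> {}"
    using tree_decomposition_hits[OF simple_subdivision T(1), of "{..<n}" S] Ssub conn meet by auto
  have simpT: "simple_graph T" using T(1) by (simp add: tree_decomposition_def is_tree_def)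
  have "card (B t) \<le> Max ((\<lambda>t. card (B t)) ` pverts T)"
    using t(1) simple_graph_finite[OF simpT] by (intro Max_ge) auto
  then have cardB: "card (B t) \<le> treewidth G' + 1" using T(2) by (simp add: decomposition_width_def)
  have Bsub: "B t \<subseteq> pverts G'" using T(1) t(1) by (auto simp: tree_decomposition_def)
  then have finB: "finite (B t)" using simple_graph_finite[OF simple_subdivision] finite_subset by blast
  \<comment> \<open>An original vertex belongs to its own row only, a new one to the rows of the two
    endpoints of its edge.\<close>
  have two: "card {i. x \<in> S i} \<le> 2 \<and> finite {i. x \<in> S i}" for x
  proof -
    have "\<exists>a b. {i. x \<in> S i} \<subseteq> {a, b}"
    proof (cases "x \<in> pverts ?G")
      case True
      have "i = row x" if "x \<in> S i" for i
        using SE[OF that] True fresh by blast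
      then show ?thesis by blast
    next
      case False
      show ?thesis
      proof (cases "\<exists>i. x \<in> S i")
        case True
        then obtain u v where uv: "(u, v) \<in> parcs ?G" "x \<in> set (P u v)" using SE False arc_verts by metis
        have "i = row u \<or> i = row v" if xi: "x \<in> S i" for i
        proof -
          obtain a b where ab: "(a, b) \<in> parcs ?G" "row a = i" "x \<in> set (P a b)"
            using SE[OF xi] False arc_verts by metis
          then have "{a, b} = {u, v}" using disj[OF ab(1) uv(1)] uv(2) by blast
          then show ?thesis using ab(2) by (auto simp: doubleton_eq_iff)
        qed
        then show ?thesis by blast
      qed auto
    qed
    then obtain a b where ab: "{i. x \<in> S i} \<subseteq> {a, b}" by blast
    then have "card {i. x \<in> S i} \<le> card {a, b}" by (intro card_mono) auto
    moreover have "card {a, b} \<le> 2" using card_length[of "[a, b]"] by simp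
    ultimately show ?thesis using ab finite_subset[of _ "{a, b}"] by auto
  qed
  have "{..<n} \<subseteq> (\<Union>x\<in>B t. {i. x \<in> S i})" using t(2) by blast
  then have "n \<le> card (\<Union>x\<in>B t. {i. x \<in> S i})"
    using card_mono[of "\<Union>x\<in>B t. {i. x \<in> S i}" "{..<n}"] finB two by auto
  also have "\<dots> \<le> (\<Sum>x\<in>B t. card {i. x \<in> S i})" by (rule card_UN_le[OF finB])
  also have "\<dots> \<le> (\<Sum>x\<in>B t. 2)" using two by (intro sum_mono) blast
  also have "\<dots> = 2 * card (B t)" by simp
  finally show ?thesis by (rule order_trans[OF _ mult_le_mono2[OF cardB]])
qed

section \<open>Properties of the class of subdivided subcubic graphs\<close>

lemma subdivision_class_unbounded_treewidth:
  assumes "0 < k"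
  shows "\<not> bounded_treewidth (subdivision_class k subcubic_graphs)"
proof
  assume "bounded_treewidth (subdivision_class k subcubic_graphs)"
  then obtain c where c: "\<And>G. G \<in> subdivision_class k subcubic_graphs \<Longrightarrow> treewidth G \<le> c"
    by (auto simp: bounded_treewidth_def)
  define n where "n = 2 * (c + 1) + 1"
  have G: "crossing_graph n \<in> subcubic_graphs" by (rule crossing_graph_subcubic) (simp add: n_def)
  then have simple: "simple_graph (crossing_graph n)" by (simp add: subcubic_graphs_def)
  obtain G' where G': "edge_subdivision (\<lambda>_. k) (crossing_graph n) G'"
    using edge_subdivision_exists[OF simple] by blast
  then obtain P where "subdivision (crossing_graph n) G' k P"
    using edge_subdivision_imp_subdivision[OF simple] by blast
  then have "n \<le> 2 * (treewidth G' + 1)"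
    using assms by (intro crossing_subdivision_treewidth) (auto simp: n_def)
  moreover have "treewidth G' \<le> c" using G G' by (intro c) (auto simp: subdivision_class_def)
  ultimately show False by (simp add: n_def)
qed

lemma subdivision_class_subgraph_free:
  assumes "\<And>H. H \<in> \<H> \<Longrightarrow> simple_graph H \<and> H \<notin> \<S> \<and> card (pverts H) < k"
  shows "subdivision_class k subcubic_graphs \<subseteq> subgraph_free \<H>"
proof
  fix G' assume "G' \<in> subdivision_class k subcubic_graphs"
  then obtain G where G: "simple_graph G" "\<And>v. v \<in> pverts G \<Longrightarrow> out_degree (with_proj G) v \<le> 3"
    "edge_subdivision (\<lambda>_. k) G G'"
    by (auto simp: subdivision_class_def subcubic_graphs_def)
  obtain P where "subdivision G G' k P" using edge_subdivision_imp_subdivision[OF G(1,3)] by blast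
  then interpret subdivision G G' k P .
  have "\<not> contains_subgraph G' H" if "H \<in> \<H>" for H
  proof
    assume "contains_subgraph G' H"
    then obtain f where "inj_on f (pverts H)" "f ` pverts H \<subseteq> pverts G'" "map_prod f f ` parcs H \<subseteq> parcs G'"
      by (rule contains_subgraphD)
    then have "H \<in> \<S>" using assms[OF that] G(2) by (intro small_subgraph_mem_\<S>) auto
    then show False using assms[OF that] by blast
  qed
  then show "G' \<in> subgraph_free \<H>" using simple_subdivision by (simp add: subgraph_free_def)
qed

section \<open>The dichotomy\<close>

theorem theorem3:
  fixes \<Phi> :: "('d, 's) graph_problem"
    and eff hard :: "('d, 's) graph_problem \<Rightarrow> bool"
    and \<H> :: "ngraph set"
  assumes "subclass_inherited eff \<Phi>"
    and "superclass_inherited hard \<Phi>"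
    and "C123_problem eff hard \<Phi>"
    and "finite \<H>"
    and "\<forall>H\<in>\<H>. simple_graph H"
  shows "((\<exists>H\<in>\<H>. H \<in> \<S>) \<longleftrightarrow> bounded_treewidth (subgraph_free \<H>)) \<and>
         ((\<exists>H\<in>\<H>. H \<in> \<S>) \<longrightarrow> eff (on_class \<Phi> (subgraph_free \<H>))) \<and>
         (\<not> (\<exists>H\<in>\<H>. H \<in> \<S>) \<longrightarrow> hard (on_class \<Phi> (subgraph_free \<H>)))"
proof (cases "\<exists>H\<in>\<H>. H \<in> \<S>")
  case True
  then have bounded: "bounded_treewidth (subgraph_free \<H>)"
    using \<S>_imp_bounded_treewidth by blast
  moreover have "C1 eff \<Phi>" using assms(3) by (simp add: C123_problem_def)
  ultimately have "eff (on_class \<Phi> (subgraph_free \<H>))"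
    by (auto simp: C1_def graph_class_def subgraph_free_def)
  then show ?thesis using True bounded by blast
next
  case False
  \<comment> \<open>A number above all orders in \<open>\<H>\<close>. Condition \<open>C3\<close>
    multiplies it by an unknown \<open>k\<close>, which only lengthens the subdivided edges.\<close>
  define p where "p = Suc (\<Sum>H\<in>\<H>. card (pverts H))"
  have small: "card (pverts H) < p" if "H \<in> \<H>" for H
    using member_le_sum[of H \<H> "\<lambda>H. card (pverts H)"] that assms(4) by (simp add: p_def less_Suc_eq_le)
  \<comment> \<open>Used with the factor \<open>k\<close> from \<open>C3\<close> for hardness and
    with \<open>k = 1\<close> for unbounded treewidth.\<close>
  have sub: "subdivision_class (k * p) subcubic_graphs \<subseteq> subgraph_free \<H>" if "1 \<le> k" for k
  proof (rule subdivision_class_subgraph_free)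
    fix H assume "H \<in> \<H>"
    moreover have "p \<le> k * p" using that by simp
    ultimately show "simple_graph H \<and> H \<notin> \<S> \<and> card (pverts H) < k * p"
      using less_le_trans[OF small[of H]] False assms(5) by blast
  qed
  have "\<not> bounded_treewidth (subgraph_free \<H>)"
  proof -
    have "subdivision_class p subcubic_graphs \<subseteq> subgraph_free \<H>" using sub[of 1] by simp
    moreover have "\<not> bounded_treewidth (subdivision_class p subcubic_graphs)"
      by (rule subdivision_class_unbounded_treewidth) (simp add: p_def)
    ultimately show ?thesis unfolding bounded_treewidth_def by blast
  qed
  moreover have "hard (on_class \<Phi> (subgraph_free \<H>))"
  proof -
    have "1 \<le> p" by (simp add: p_def)
    then obtain k where k: "1 \<le> k" "hard (on_class \<Phi> (subdivision_class (k * p) subcubic_graphs))"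
      using assms(3) unfolding C123_problem_def C2_def C3_def by blast
    moreover have "graph_class (subgraph_free \<H>)" by (simp add: graph_class_def subgraph_free_def)
    ultimately show ?thesis using assms(2) sub[OF k(1)] unfolding superclass_inherited_def by blast
  qed
  ultimately show ?thesis using False by blast
qed

end
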